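(* Let $E=(M(1),\dots,M(n))$ be an ordered collection of $n$ multiplicity sequences. If $S(T)\in\sigma(E)$, then there exists $G(T)\subseteq\mathbb N^n$ with $\mathrm{Arf}(G(T))=S(T)$ and $|G(T)|=C_E+\lceil\log_2(n)\rceil$.
   Context: $\mathbb N=\{0,1,2,\dots\}$; $v[i]$ is the $i$-th component of $v$; $\mathbb N^n$ has the componentwise order and $\min(a,b)$ is the componentwise minimum. $\lceil d\rceil=\min\{m\in\mathbb N:m\ge d\}$. Arf semigroups. A good semigroup $S$ of $\mathbb N^n$ is a submonoid of $(\mathbb N^n,+)$ such that: (i) $\min(a,b)\in S$ for $a,b\in S$; (ii) if $a\neq b$ in $S$ and $a[i]=b[i]$, then there is $c\in S$ with $c[i]>a[i]$, $c[j]\ge\min(a[j],b[j])$ for $j\ne i$, with equality whenever $a[j]\ne b[j]$; (iii) there is $\delta\in S$ with $\delta+\mathbb N^n\subseteq S$. It is local if $\mathbf 0$ is its only element with a zero component. An Arf semigroup of $\mathbb N^n$ is here a local good semigroup $S$ such that $\{\beta\in S:\beta\ge\alpha\}-\alpha$ is a semigroup for every $\alpha\in S$. For $G\subseteq\mathbb N^n$, $\mathrm{Arf}(G)$ denotes the minimum, with respect to inclusion, of the set of Arf semigroups of $\mathbb N^n$ containing $G$, when this minimum exists; $\mathrm{Arf}(G)=S(T)$ means that the minimum exists and equals $S(T)$. Multiplicity sequences. A multiplicity sequence is a sequence $M(i)=(m_{i,l})_{l\ge1}$ of positive integers, equal to $1$ for all large $l$, such that for every $l\ge 1$ there is a (unique)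 $s_{i,l}\ge l+1$ with $m_{i,l}=\sum_{k=l+1}^{s_{i,l}}m_{i,k}$. Trees. $\tau(E)$ is the set of trees $T$ with $n$ infinite branches and nodes labelled by vectors of $\mathbb N^n$, $\mathbf n_i^l$ being the node of the $i$-th branch at level $l\ge1$ (joined to $\mathbf n_i^{l+1}$), such that: all branches are glued at level $1$ (branches $i,j$ are glued at level $l$ if $\mathbf n_i^l$ and $\mathbf n_j^l$ are the same node; then they are glued at all lower levels); $\mathbf n_i^l[i]=m_{i,l}$; for all large $l$, $\mathbf n_i^l$ is the $i$-th unit vector; $\mathbf n_i^l[h]=0$ if and only if $\mathbf n_i^l$ is not in the $h$-th branch; and each $\mathbf n_i^l$ equals the sum of the nodes other than $\mathbf n_i^l$ itself in some finite subtree of $T$ rooted in $\mathbf n_i^l$. The semigroup of $T$ is $S(T)=\{\mathbf 0\}\cup\{\sum_{\mathbf n\in T'}\mathbf n: T'\text{ a finite subtree of }T\text{ rooted in the root }\mathbf n_1^1\}$; it is an Arf semigroup, and $\sigma(E)=\{S(T):T\in\tau(E)\}$. Characters. The restriction number $r(m_{i,j})$ is the number of the sums $m_{i,q}=\sum_{h=1}^{k}m_{i,q+h}$ in which $m_{i,j}$ appears as a summand, i.e. the number of $q<j$ with $s_{i,q}\ge j$. $\mathrm{PChar}_E(i)=\{j\ge1: r(m_{i,j})<r(m_{i,j+1})\}$ (a finite set), and $C_E=\max\{|\mathrm{PChar}_E(i)|: i=1,\dots,n\}$. *)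

theory Defs
  imports "HOL-Analysis.Analysis"
begin

text \<open>
  The set \<open>\<nat>\<^sup>n\<close> is the type \<open>nat ^ 'n\<close>, with \<open>n = CARD('n)\<close>; its order, addition and
  subtraction are the componentwise ones.
\<close>

section \<open>Arf semigroups\<close>

text \<open>
  The overloaded constant \<open>min\<close> is not the componentwise minimum on \<open>nat ^ 'n\<close>, since that
  order is not linear.
\<close>

definition vmin :: "nat ^ 'n \<Rightarrow> nat ^ 'n \<Rightarrow> nat ^ 'n" where
  "vmin a b = (\<chi> i. min (a $ i) (b $ i))"

definition submonoid_of_vec :: "(nat ^ 'n) set \<Rightarrow> bool" where
  "submonoid_of_vec S \<longleftrightarrow> 0 \<in> S \<and> (\<forall>a\<in>S. \<forall>b\<in>S. a + b \<in> S)"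

definition good_semigroup :: "(nat ^ 'n) set \<Rightarrow> bool" where
  "good_semigroup S \<longleftrightarrow>
     submonoid_of_vec S \<and>
     (\<forall>a\<in>S. \<forall>b\<in>S. vmin a b \<in> S) \<and>
     (\<forall>a\<in>S. \<forall>b\<in>S. \<forall>i. a \<noteq> b \<and> a $ i = b $ i \<longrightarrow>
        (\<exists>c\<in>S. c $ i > a $ i \<and>
           (\<forall>j. j \<noteq> i \<longrightarrow> c $ j \<ge> min (a $ j) (b $ j) \<and>
              (a $ j \<noteq> b $ j \<longrightarrow> c $ j = min (a $ j) (b $ j))))) \<and>
     (\<exists>\<delta>\<in>S. \<forall>v. \<delta> + v \<in> S)"

definition local_semigroup :: "(nat ^ 'n) set \<Rightarrow> bool" where
  "local_semigroup S \<longleftrightarrow> (\<forall>a\<in>S. (\<exists>i. a $ i = 0) \<longleftrightarrow> a = 0)"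

text \<open>The truncated subtraction of \<open>nat\<close> is harmless below, as \<open>\<alpha> \<le> \<beta>\<close>.\<close>

definition arf_semigroup :: "(nat ^ 'n) set \<Rightarrow> bool" where
  "arf_semigroup S \<longleftrightarrow> good_semigroup S \<and> local_semigroup S \<and>
     (\<forall>\<alpha>\<in>S. submonoid_of_vec {\<beta> - \<alpha> | \<beta>. \<beta> \<in> S \<and> \<alpha> \<le> \<beta>})"

text \<open>\<open>is_Arf G S\<close> says that \<open>Arf(G)\<close> exists and is equal to \<open>S\<close>.\<close>

definition is_Arf :: "(nat ^ 'n) set \<Rightarrow> (nat ^ 'n) set \<Rightarrow> bool" where
  "is_Arf G S \<longleftrightarrow> arf_semigroup S \<and> G \<subseteq> S \<and>
     (\<forall>S'. arf_semigroup S' \<and> G \<subseteq> S' \<longrightarrow> S \<subseteq> S')"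

section \<open>Multiplicity sequences\<close>

text \<open>
  All sequences and levels are indexed from \<open>1\<close>; the value of a sequence at \<open>0\<close> plays no role.
\<close>

definition is_stop :: "(nat \<Rightarrow> nat) \<Rightarrow> nat \<Rightarrow> nat \<Rightarrow> bool" where
  "is_stop m l s \<longleftrightarrow> s \<ge> l + 1 \<and> m l = (\<Sum>k = l+1..s. m k)"

definition multiplicity_sequence :: "(nat \<Rightarrow> nat) \<Rightarrow> bool" where
  "multiplicity_sequence m \<longleftrightarrow>
     (\<forall>l\<ge>1. m l > 0) \<and>
     (\<exists>L. \<forall>l\<ge>L. m l = 1) \<and>
     (\<forall>l\<ge>1. \<exists>!s. is_stop m l s)"

definition stop :: "(nat \<Rightarrow> nat) \<Rightarrow> nat \<Rightarrow> nat" where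
  "stop m l = (THE s. is_stop m l s)"

definition restriction_number :: "(nat \<Rightarrow> nat) \<Rightarrow> nat \<Rightarrow> nat" where
  "restriction_number m j = card {q. 1 \<le> q \<and> q < j \<and> j \<le> stop m q}"

definition PChar :: "(nat \<Rightarrow> nat) \<Rightarrow> nat set" where
  "PChar m = {j. 1 \<le> j \<and> restriction_number m j < restriction_number m (j + 1)}"

definition C_num :: "('n::finite \<Rightarrow> nat \<Rightarrow> nat) \<Rightarrow> nat" where
  "C_num M = Max (range (\<lambda>i. card (PChar (M i))))"

section \<open>Multiplicity trees\<close>

text \<open>
  A tree with branches indexed by \<open>'n\<close> is given by the relations \<open>glued T l\<close> (the branches glued
  at level \<open>l\<close>) and by the labels of its nodes. A node is identified with its level together with
  the set of branches through it, so that distinct nodes may carry the same label. The values of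
  \<open>glued\<close> at \<open>0\<close> and of \<open>label\<close> outside the nodes play no role.
\<close>

record ('n::finite) mtree =
  glued :: "nat \<Rightarrow> ('n \<times> 'n) set"
  label :: "nat \<times> 'n set \<Rightarrow> nat ^ 'n"

definition node :: "'n::finite mtree \<Rightarrow> 'n \<Rightarrow> nat \<Rightarrow> nat \<times> 'n set" where
  "node T i l = (l, glued T l `` {i})"

definition is_tree :: "'n::finite mtree \<Rightarrow> bool" where
  "is_tree T \<longleftrightarrow> (\<forall>l\<ge>1. equiv UNIV (glued T l) \<and> glued T (l + 1) \<subseteq> glued T l)"

text \<open>
  A finite subtree rooted in \<open>r\<close>: a finite set of nodes which contains \<open>r\<close> and, with any other
  node, the unique node it is joined to at the preceding level. Since levels start at \<open>1\<close>, all
  its nodes are then joined to \<open>r\<close> by a descending path.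
\<close>

definition finite_subtree :: "'n::finite mtree \<Rightarrow> nat \<times> 'n set \<Rightarrow> (nat \<times> 'n set) set \<Rightarrow> bool" where
  "finite_subtree T r V \<longleftrightarrow> finite V \<and> r \<in> V \<and> r \<in> {node T i l | i l. l \<ge> 1} \<and>
     (\<forall>v\<in>V - {r}. \<exists>i l. l \<ge> 1 \<and> v = node T i (l + 1) \<and> node T i l \<in> V)"

definition tau_trees :: "('n::finite \<Rightarrow> nat \<Rightarrow> nat) \<Rightarrow> 'n mtree set" where
  "tau_trees M = {T. is_tree T \<and>
     (\<forall>i j. node T i 1 = node T j 1) \<and>
     (\<forall>i. \<forall>l\<ge>1. label T (node T i l) $ i = M i l) \<and>
     (\<exists>L. \<forall>l\<ge>L. \<forall>i. label T (node T i l) = axis i 1) \<and>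
     (\<forall>i h. \<forall>l\<ge>1. label T (node T i l) $ h = 0 \<longleftrightarrow> node T i l \<noteq> node T h l) \<and>
     (\<forall>i. \<forall>l\<ge>1. \<exists>V. finite_subtree T (node T i l) V \<and>
        label T (node T i l) = (\<Sum>v\<in>V - {node T i l}. label T v))}"

text \<open>For the trees in \<open>tau_trees M\<close> all the nodes \<open>node T i 1\<close> are the root.\<close>

definition tree_semigroup :: "'n::finite mtree \<Rightarrow> (nat ^ 'n) set" where
  "tree_semigroup T = {0} \<union> {\<Sum>v\<in>V. label T v | V i. finite_subtree T (node T i 1) V}"

definition sigma_semigroups :: "('n::finite \<Rightarrow> nat \<Rightarrow> nat) \<Rightarrow> (nat ^ 'n) set set" where
  "sigma_semigroups M = tree_semigroup ` tau_trees M"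

end

theory Submission
  imports Defs
begin

text \<open>
  An element of \<open>S(T)\<close> is given by the depths \<open>d i\<close> at which a finite subtree leaves the branches:
  its \<open>i\<close>-th component is the sum of the first \<open>d i\<close> multiplicities. In an Arf semigroup, the
  elements of depths \<open>q - 1\<close> and \<open>q\<close> on a branch yield one of depth \<open>s\<close>, where \<open>m q\<close> is the sum
  of the multiplicities at the levels \<open>q + 1, \<dots>, s\<close>, because \<open>2 y - z\<close> has this depth. A level is a
  character exactly if it is no such \<open>s\<close>, so \<open>C\<close> subtrees, the \<open>t\<close>-th of them cut at the \<open>t\<close>-th
  characters, yield elements of every depth on every branch. The other generators are subtrees
  that separate any two branches at the last level at which these are glued. With at most \<open>2\<^sup>b\<close>
  branches, \<open>b\<close> subtrees suffice: at a ramification, distinct sets of subtrees that continue can be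
  assigned to the outgoing directions, a direction with \<open>k\<close> branches getting at least \<open>log k\<close> of them.
\<close>

section \<open>Preliminaries\<close>

lemma min_eqI:
  fixes x y l :: nat
  assumes "\<And>k. k \<le> l \<Longrightarrow> k \<le> x \<longleftrightarrow> k \<le> y"
  shows "min l x = min l y"
  using assms[of "min l x"] assms[of "min l y"] by linarith

lemma le_Least_iff: "P (k::nat) \<Longrightarrow> l \<le> (LEAST j. P j) \<longleftrightarrow> (\<forall>j<l. \<not> P j)"
  by (meson LeastI le_less_linear less_le_trans not_less_Least)

section \<open>Distinct subsets of prescribed sizes\<close>

text \<open>Greedy matching: all elements but one of least demand \<open>e c\<close> are placed
  first; they take fewer than \<open>card K\<close> values, while at least \<open>card K\<close>
  elements of \<open>F\<close> have weight \<open>e c\<close> or more.\<close>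

lemma exists_inj_on_above:
  fixes e :: "'a \<Rightarrow> nat" and w :: "'b \<Rightarrow> nat"
  assumes "finite K" "finite F"
    and "\<And>n. card {c\<in>K. n \<le> e c} \<le> card {u\<in>F. n \<le> w u}"
  shows "\<exists>f. inj_on f K \<and> (\<forall>c\<in>K. f c \<in> F \<and> e c \<le> w (f c))"
  using assms(1,3)
proof (induction "card K" arbitrary: K)
  case 0
  then show ?case by simp
next
  case (Suc k)
  then have "K \<noteq> {}" by auto
  then obtain c where c: "c \<in> K" "\<And>x. x \<in> K \<Longrightarrow> e c \<le> e x"
    using ex_min_if_finite[of "e ` K"] Suc.prems(1) by (fastforce simp: not_less)
  have le: "card {x \<in> K - {c}. n \<le> e x} \<le> card {u\<in>F. n \<le> w u}" for n
    using Suc.prems(2)[of n] card_mono[of "{x \<in> K. n \<le> e x}" "{x \<in> K - {c}. n \<le> e x}"] Suc.prems(1)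
    by force
  have "k = card (K - {c})" using Suc.hyps(2) Suc.prems(1) c(1) by simp
  then obtain f where f: "inj_on f (K - {c})" "\<forall>x\<in>K - {c}. f x \<in> F \<and> e x \<le> w (f x)"
    using Suc.hyps(1)[OF _ _ le] Suc.prems(1) by auto
  have "card (f ` (K - {c})) < card K"
    using card_image[OF f(1)] card_Diff1_less[OF Suc.prems(1) c(1)] by simp
  also have "card K = card {x\<in>K. e c \<le> e x}" using c by (intro arg_cong[of _ _ card]) auto
  also have "\<dots> \<le> card {u\<in>F. e c \<le> w u}" by (rule Suc.prems)
  finally have "\<not> {u\<in>F. e c \<le> w u} \<subseteq> f ` (K - {c})"
    using Suc.prems(1) by (meson card_mono finite_Diff finite_imageI not_less)
  then obtain u where u: "u \<in> F" "e c \<le> w u" "u \<notin> f ` (K - {c})" by blast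
  have "inj_on (f(c := u)) K"
    using f(1) u(3) unfolding inj_on_def by auto
  then show ?case using f(2) u by (intro exI[of _ "f(c := u)"]) auto
qed

text \<open>Joining a fixed \<open>k\<close>-subset \<open>F\<close> to the nonempty subsets of
  \<open>B - F\<close> gives that many sets.\<close>

lemma card_large_subsets:
  assumes "finite B" "k < card B"
  shows "2 ^ (card B - k) - 1 \<le> card {U \<in> Pow B. Suc k \<le> card U}"
proof -
  obtain F where F: "F \<subseteq> B" "card F = k"
    using obtain_subset_with_card_n[of k B] assms(2) by auto
  have fin: "finite F" using F assms(1) finite_subset by blast
  have "inj_on (\<lambda>X. F \<union> X) (Pow (B - F) - {{}})"
    by (rule inj_onI) blast
  moreover have "(\<lambda>X. F \<union> X) ` (Pow (B - F) - {{}}) \<subseteq> {U \<in> Pow B. Suc k \<le> card U}"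
  proof (rule image_subsetI)
    fix X assume "X \<in> Pow (B - F) - {{}}"
    then have X: "X \<subseteq> B - F" "X \<noteq> {}" by auto
    then have "finite X" using assms(1) by (meson finite_Diff finite_subset)
    then have "card (F \<union> X) = card F + card X" using X fin by (intro card_Un_disjoint) auto
    moreover have "0 < card X" using X \<open>finite X\<close> by (simp add: card_gt_0_iff)
    ultimately show "F \<union> X \<in> {U \<in> Pow B. Suc k \<le> card U}" using F X by auto
  qed
  ultimately have "card (Pow (B - F) - {{}}) \<le> card {U \<in> Pow B. Suc k \<le> card U}"
    using assms(1) by (intro card_inj_on_le) auto
  moreover have "card (Pow (B - F) - {{}}) = 2 ^ (card B - k) - 1"
    using F fin assms(1) by (simp add: card_Diff_subset card_Pow)
  ultimately show ?thesis by simp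
qed

text \<open>With \<open>e c\<close> the rounded-up binary logarithm of \<open>n c\<close>, the
  elements with \<open>e c > k\<close> satisfy \<open>n c \<ge> 2 ^ k + 1\<close>; there are at most
  \<open>2 ^ (card B - k) - 1\<close> of them, hence no more than subsets of \<open>B\<close> with
  over \<open>k\<close> elements.\<close>

lemma exists_distinct_codes:
  fixes n :: "'a \<Rightarrow> nat"
  assumes "finite K" "finite B" "\<And>c. c \<in> K \<Longrightarrow> 0 < n c" "(\<Sum>c\<in>K. n c) \<le> 2 ^ card B"
  shows "\<exists>U. inj_on U K \<and> (\<forall>c\<in>K. U c \<subseteq> B \<and> n c \<le> 2 ^ card (U c))"
proof -
  define e where "e c = (LEAST k. n c \<le> 2 ^ k)" for c
  have e: "n c \<le> 2 ^ e c" for c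
    unfolding e_def by (rule LeastI[of _ "n c"]) (simp add: less_imp_le)
  have less_e: "2 ^ k < n c" if "k < e c" for k c
    using not_less_Least[of k "\<lambda>k. n c \<le> 2 ^ k"] that by (simp add: e_def)
  have "card {c\<in>K. t \<le> e c} \<le> card {U\<in>Pow B. t \<le> card U}" for t
  proof (cases t)
    case 0
    have "card K = (\<Sum>c\<in>K. 1)" by simp
    also have "\<dots> \<le> (\<Sum>c\<in>K. n c)" using assms(3) by (intro sum_mono) (simp add: Suc_leI)
    also have "\<dots> \<le> card (Pow B)" using assms by (simp add: card_Pow)
    finally show ?thesis using 0 by (simp add: Pow_def)
  next
    case (Suc k)
    define A where "A = {c\<in>K. t \<le> e c}"
    have A: "finite A" "A \<subseteq> K" using assms(1) by (auto simp: A_def)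
    show ?thesis
    proof (cases "A = {}")
      case True
      then have "card {c\<in>K. t \<le> e c} = 0" by (simp only: A_def card.empty)
      then show ?thesis by linarith
    next
      case False
      then have "0 < card A" using A by (simp add: card_gt_0_iff)
      have "card A * 2 ^ k < card A * (2 ^ k + 1)" using \<open>0 < card A\<close> by simp
      also have "\<dots> = (\<Sum>c\<in>A. 2 ^ k + 1)" by simp
      also have "\<dots> \<le> (\<Sum>c\<in>A. n c)"
        using less_e Suc by (intro sum_mono) (auto simp: A_def Suc_le_eq)
      also have "\<dots> \<le> (\<Sum>c\<in>K. n c)" using A assms(1) by (intro sum_mono2) auto
      also have "\<dots> \<le> 2 ^ card B" by fact
      finally have less: "card A * 2 ^ k < 2 ^ card B" .
      have "2 ^ k \<le> card A * 2 ^ k" using \<open>0 < card A\<close> by simp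
      then have "(2::nat) ^ k < 2 ^ card B" using less by (rule le_less_trans)
      then have k: "k < card B" by simp
      then have "(2::nat) ^ card B = 2 ^ (card B - k) * 2 ^ k"
        by (simp flip: power_add)
      then have "card A < 2 ^ (card B - k)" using less by simp
      then show ?thesis using card_large_subsets[OF assms(2) k] Suc by (simp add: A_def)
    qed
  qed
  then obtain U where "inj_on U K" "\<forall>c\<in>K. U c \<in> Pow B \<and> e c \<le> card (U c)"
    using exists_inj_on_above[of K "Pow B" e card] assms by auto
  moreover have "n c \<le> 2 ^ card (U c)" if "e c \<le> card (U c)" for c
    using le_trans[OF e power_increasing[OF that]] by simp
  ultimately show ?thesis by blast
qed

section \<open>Closure properties of good and Arf semigroups\<close>

lemma good_semigroup_vmin:
  "good_semigroup S \<Longrightarrow> a \<in> S \<Longrightarrow> b \<in> S \<Longrightarrow> vmin a b \<in> S"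
  by (simp add: good_semigroup_def)

lemma good_semigroup_exchange:
  assumes "good_semigroup S" "a \<in> S" "b \<in> S" "a \<noteq> b" "a $ i = b $ i"
  shows "\<exists>c\<in>S. c $ i > a $ i \<and>
           (\<forall>j. j \<noteq> i \<longrightarrow> c $ j \<ge> min (a $ j) (b $ j) \<and>
              (a $ j \<noteq> b $ j \<longrightarrow> c $ j = min (a $ j) (b $ j)))"
  using assms unfolding good_semigroup_def by simp

text \<open>The Arf condition makes \<open>(x - z) + (y - z)\<close> some \<open>\<beta> - z\<close>
  with \<open>\<beta>\<close> in \<open>S\<close>, and this determines
  \<open>\<beta>\<close>.\<close>

lemma arf_semigroupD:
  assumes "arf_semigroup S" "x \<in> S" "y \<in> S" "z \<in> S" "z \<le> x" "z \<le> y"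
  shows "x + y - z \<in> S"
proof -
  have "submonoid_of_vec {\<beta> - z | \<beta>. \<beta> \<in> S \<and> z \<le> \<beta>}"
    using assms unfolding arf_semigroup_def by blast
  then have "(x - z) + (y - z) \<in> {\<beta> - z | \<beta>. \<beta> \<in> S \<and> z \<le> \<beta>}"
    using assms unfolding submonoid_of_vec_def by blast
  then obtain \<beta> where \<beta>: "\<beta> \<in> S" "z \<le> \<beta>" "(x - z) + (y - z) = \<beta> - z" by blast
  have "\<beta> = x + y - z"
  proof (rule vec_eq_iff[THEN iffD2], rule allI)
    fix i
    have "x $ i - z $ i + (y $ i - z $ i) = \<beta> $ i - z $ i"
      using \<beta>(3) by (metis vector_add_component vector_minus_component)
    moreover have "z $ i \<le> x $ i" "z $ i \<le> y $ i" "z $ i \<le> \<beta> $ i"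
      using assms \<beta> by (auto simp: less_eq_vec_def)
    ultimately show "\<beta> $ i = (x + y - z) $ i" by simp
  qed
  then show ?thesis using \<beta> by simp
qed

lemma Min_in_good_semigroup:
  fixes f :: "'a \<Rightarrow> nat ^ 'n::finite"
  assumes "good_semigroup S" "finite K" "K \<noteq> {}" "\<And>k. k \<in> K \<Longrightarrow> f k \<in> S"
  shows "(\<chi> i. Min ((\<lambda>k. f k $ i) ` K)) \<in> S"
  using assms(2-)
proof (induction K rule: finite_ne_induct)
  case (singleton k)
  then show ?case by simp
next
  case (insert k K)
  have "(\<chi> i. Min ((\<lambda>k. f k $ i) ` insert k K)) = vmin (f k) (\<chi> i. Min ((\<lambda>k. f k $ i) ` K))"
    using insert by (simp add: vmin_def vec_eq_iff)
  then show ?case using insert good_semigroup_vmin[OF assms(1)] by simp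
qed

section \<open>Gluing trees\<close>

text \<open>A tree without its labels, which the multiplicities and the gluing \<open>R\<close>
  determine. That nodes are sums over subtrees is encoded by \<open>s_level\<close>: along glued
  branches the stops of \<open>q\<close> behave like the depths of a subtree.\<close>

locale gluing_tree =
  fixes m s :: "'n::finite \<Rightarrow> nat \<Rightarrow> nat" and R :: "nat \<Rightarrow> 'n \<Rightarrow> 'n \<Rightarrow> bool" and L :: nat
  assumes m_pos: "1 \<le> l \<Longrightarrow> 0 < m i l"
    and m_one: "L \<le> l \<Longrightarrow> m i l = 1"
    and s_gt: "1 \<le> q \<Longrightarrow> q < s i q"
    and m_sum: "1 \<le> q \<Longrightarrow> m i q = (\<Sum>k=q+1..s i q. m i k)"
    and R_refl: "R l i i"
    and R_sym: "R l i j \<Longrightarrow> R l j i"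
    and R_trans: "R l i j \<Longrightarrow> R l j h \<Longrightarrow> R l i h"
    and R_antimono: "R l i j \<Longrightarrow> k \<le> l \<Longrightarrow> R k i j"
    and R_one: "R 1 i j"
    and R_L: "R L i j \<Longrightarrow> i = j"
    and stop_eq: "1 \<le> q \<Longrightarrow> stop (m i) q = s i q"
    and s_level: "1 \<le> q \<Longrightarrow> R l i j \<Longrightarrow> l \<le> s i q \<longleftrightarrow> l \<le> s j q"
begin

text \<open>
  A finite subtree is recorded by the number \<open>d i\<close> of its nodes on each branch \<open>i\<close>; the zero
  depth stands for the empty subtree.
\<close>

definition compat :: "('n \<Rightarrow> nat) \<Rightarrow> bool" where
  "compat d \<longleftrightarrow> (\<forall>i j l. R l i j \<longrightarrow> (l \<le> d i \<longleftrightarrow> l \<le> d j))"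

definition height :: "'n \<Rightarrow> nat \<Rightarrow> nat" where
  "height i d = (\<Sum>k=1..d. m i k)"

definition vec_of :: "('n \<Rightarrow> nat) \<Rightarrow> nat ^ 'n" where
  "vec_of d = (\<chi> i. height i (d i))"

definition semigrp :: "(nat ^ 'n) set" where
  "semigrp = vec_of ` {d. compat d}"

lemma vec_of_nth [simp]: "vec_of d $ i = height i (d i)"
  by (simp add: vec_of_def)

section \<open>Heights on one branch\<close>

lemma height_0 [simp]: "height i 0 = 0"
  by (simp add: height_def)

lemma height_Suc [simp]: "height i (Suc d) = height i d + m i (Suc d)"
  by (simp add: height_def)

lemma height_strict_mono: "strict_mono (height i)"
  by (rule strict_monoI_Suc) (simp add: m_pos)

lemma height_less_iff [simp]: "height i a < height i b \<longleftrightarrow> a < b"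
  by (rule strict_mono_less[OF height_strict_mono])

lemma height_le_iff [simp]: "height i a \<le> height i b \<longleftrightarrow> a \<le> b"
  by (rule strict_mono_less_eq[OF height_strict_mono])

lemma height_eq_iff [simp]: "height i a = height i b \<longleftrightarrow> a = b"
  by (rule strict_mono_eq[OF height_strict_mono])

lemma height_min: "height i (min a b) = min (height i a) (height i b)"
  by (simp add: min_def)

text \<open>For \<open>y\<close> and \<open>z\<close> of depths \<open>q + 1\<close> and
  \<open>q\<close>, this makes the stop of \<open>q + 1\<close> the depth of
  \<open>2 y - z\<close>.\<close>

lemma height_stop: "height i (s i (Suc q)) = height i (Suc q) + m i (Suc q)"
proof -
  have "Suc q \<le> s i (Suc q)" using s_gt[of "Suc q" i] by simp
  then have "{1..s i (Suc q)} = {1..Suc q} \<union> {Suc q + 1..s i (Suc q)}" by auto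
  then have "height i (s i (Suc q)) = height i (Suc q) + (\<Sum>k=Suc q + 1..s i (Suc q). m i k)"
    unfolding height_def by (simp add: sum.union_disjoint)
  then show ?thesis using m_sum[of "Suc q" i] by simp
qed

lemma height_add_large:
  assumes "L \<le> a" shows "height i (a + k) = height i a + k"
  using assms by (induction k) (simp_all add: m_one)

text \<open>
  Since \<open>m (c + 1)\<close> equals \<open>height (s (c + 1)) - height (c + 1)\<close>, the case of \<open>c\<close> follows from two
  applications of the case of \<open>c + 1\<close>.
\<close>

lemma height_arf:
  assumes "c \<le> a" "c \<le> b"
  shows "\<exists>e. height i e + height i c = height i a + height i b"
  using assms
proof (induction "L - c" arbitrary: a b c rule: less_induct)
  case less
  show ?case
  proof (cases "L \<le> c")
    case True
    have "height i b = height i c + (b - c)"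
      using height_add_large[OF True, of i "b - c"] less.prems by simp
    moreover have "height i (a + (b - c)) = height i a + (b - c)"
      using True less.prems by (intro height_add_large) simp
    ultimately show ?thesis by (intro exI[of _ "a + (b - c)"]) simp
  next
    case False
    show ?thesis
    proof (cases "a = c \<or> b = c")
      case True
      then show ?thesis by (metis add.commute)
    next
      case False
      then have "Suc c \<le> a" "Suc c \<le> b" using less.prems by auto
      moreover have "L - Suc c < L - c" using \<open>\<not> L \<le> c\<close> by simp
      ultimately obtain e where e: "height i e + height i (Suc c) = height i a + height i b"
        using less.hyps by blast
      then have "height i a \<le> height i e"
        using \<open>Suc c \<le> b\<close> height_le_iff[of i "Suc c" b] by linarith
      then have "Suc c \<le> e" using \<open>Suc c \<le> a\<close> by simp
      moreover have "Suc c \<le> s i (Suc c)" using s_gt[of "Suc c" i] by simp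
      ultimately obtain f where "height i f + height i (Suc c) = height i e + height i (s i (Suc c))"
        using less.hyps \<open>L - Suc c < L - c\<close> by blast
      then have "height i f + height i c = height i a + height i b"
        using e height_stop[of i c] height_Suc[of i c] by linarith
      then show ?thesis ..
    qed
  qed
qed

lemma height_arf_ge:
  assumes "c \<le> b" "height i e + height i c = height i a + height i b"
  shows "a \<le> e"
proof -
  have "height i c \<le> height i b" using assms(1) by simp
  then have "height i a \<le> height i e" using assms(2) by linarith
  then show ?thesis by simp
qed

text \<open>The recursion of \<open>height_arf\<close> runs in parallel on two glued branches, and
  \<open>s_level\<close> makes the stops it meets agree up to level \<open>l\<close>. It ends at the
  latest when \<open>c\<close> reaches \<open>l\<close>, since \<open>e\<close> and
  \<open>e'\<close> are then both at least \<open>l\<close>.\<close>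

lemma height_arf_compat:
  assumes "R l i j" "c \<le> a" "c \<le> b" "c \<le> a'" "c \<le> b'"
    and "min l a = min l a'" "min l b = min l b'"
    and "height i e + height i c = height i a + height i b"
    and "height j e' + height j c = height j a' + height j b'"
  shows "min l e = min l e'"
  using assms(2-)
proof (induction "l - c" arbitrary: a b a' b' c e e' rule: less_induct)
  case less
  have ge: "a \<le> e" "a' \<le> e'" using height_arf_ge less.prems by blast+
  consider "l \<le> c" | "c < l" "a = c" | "c < l" "b = c" | "c < l" "c < a" "c < b"
    using less.prems by linarith
  then show ?case
  proof cases
    case 1
    then have "l \<le> e" "l \<le> e'" using ge less.prems by linarith+
    then show ?thesis by simp
  next
    case 2
    then have "a' = c" using less.prems by (auto simp: min_def split: if_splits)
    then have "e = b" "e' = b'" using less.prems 2 by (simp_all add: add.commute)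
    then show ?thesis using less.prems by simp
  next
    case 3
    then have "b' = c" using less.prems by (auto simp: min_def split: if_splits)
    then have "e = a" "e' = a'" using less.prems 3 by simp_all
    then show ?thesis using less.prems by simp
  next
    case 4
    then have 5: "c < a'" "c < b'"
      using less.prems by (auto simp: min_def split: if_splits)
    obtain f where f: "height i f + height i (Suc c) = height i a + height i b"
      using height_arf[of "Suc c" a b i] 4 by auto
    obtain f' where f': "height j f' + height j (Suc c) = height j a' + height j b'"
      using height_arf[of "Suc c" a' b' j] 5 by auto
    have dec: "l - Suc c < l - c" using 4 by simp
    have "min l f = min l f'"
      by (rule less.hyps[OF dec _ _ _ _ _ _ f f']) (use 4 5 less.prems in simp_all)
    moreover have "min l (s i (Suc c)) = min l (s j (Suc c))"
    proof -
      have "k \<le> s i (Suc c) \<longleftrightarrow> k \<le> s j (Suc c)" if "k \<le> l" for k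
        using s_level[of "Suc c" k i j] R_antimono[OF assms(1) that] by simp
      then show ?thesis
        by (rule min_eqI)
    qed
    moreover have "height i e + height i (Suc c) = height i f + height i (s i (Suc c))"
      using f less.prems(7) height_stop[of i c] height_Suc[of i c] by linarith
    moreover have "height j e' + height j (Suc c) = height j f' + height j (s j (Suc c))"
      using f' less.prems(8) height_stop[of j c] height_Suc[of j c] by linarith
    moreover have "Suc c \<le> f" using height_arf_ge[OF _ f] 4 by linarith
    moreover have "Suc c \<le> f'" using height_arf_ge[OF _ f'] 5 by linarith
    moreover have "Suc c \<le> s i (Suc c)" "Suc c \<le> s j (Suc c)"
      using s_gt[of "Suc c"] by (simp_all add: less_imp_le)
    ultimately show ?thesis using less.hyps[OF dec] by blast
  qed
qed

section \<open>Compatible depths\<close>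

lemma compat_iff_min: "compat d \<longleftrightarrow> (\<forall>i j l. R l i j \<longrightarrow> min l (d i) = min l (d j))"
proof
  assume d: "compat d"
  show "\<forall>i j l. R l i j \<longrightarrow> min l (d i) = min l (d j)"
  proof (intro allI impI)
    fix i j l assume "R l i j"
    then have "k \<le> d i \<longleftrightarrow> k \<le> d j" if "k \<le> l" for k
      using d R_antimono[OF _ that] unfolding compat_def by blast
    then show "min l (d i) = min l (d j)"
      by (rule min_eqI)
  qed
next
  assume "\<forall>i j l. R l i j \<longrightarrow> min l (d i) = min l (d j)"
  then show "compat d" unfolding compat_def by (metis min.orderE min.cobounded2)
qed

lemma compatD: "compat d \<Longrightarrow> R l i j \<Longrightarrow> l \<le> d i \<longleftrightarrow> l \<le> d j"
  unfolding compat_def by blast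

text \<open>Level \<open>d i\<close> is the last one of the subtree on branch \<open>i\<close>;
  gluing one level further forces it to leave branch \<open>j\<close> at the same level.\<close>

lemma compat_eqD:
  assumes "compat d" "R (Suc (d i)) i j" shows "d j = d i"
proof -
  have "min (Suc (d i)) (d i) = min (Suc (d i)) (d j)"
    using assms unfolding compat_iff_min by blast
  then show ?thesis by (auto simp: min_def split: if_splits)
qed

lemma compat_min: "compat d \<Longrightarrow> compat e \<Longrightarrow> compat (\<lambda>i. min (d i) (e i))"
  unfolding compat_def by simp

lemma compat_Min:
  assumes "finite K" "K \<noteq> {}" "\<And>k. k \<in> K \<Longrightarrow> compat (f k)"
  shows "compat (\<lambda>i. Min ((\<lambda>k. f k i) ` K))"
  using assms unfolding compat_def by simp

lemma compat_const: "compat (\<lambda>_. c)"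
  by (simp add: compat_def)

lemma compat_large: "(\<And>i. L \<le> d i) \<Longrightarrow> compat d"
  unfolding compat_def
proof (intro allI impI)
  fix i j l assume large: "\<And>i. L \<le> d i" and R: "R l i j"
  show "l \<le> d i \<longleftrightarrow> l \<le> d j"
  proof (cases "l \<le> L")
    case True
    then show ?thesis using large[of i] large[of j] by linarith
  next
    case False
    then have "i = j" using R_L R_antimono[OF R, of L] by simp
    then show ?thesis by simp
  qed
qed

text \<open>The branches through the node of \<open>k\<close> at level \<open>a + 1\<close> are cut
  at \<open>a\<close>, the others at \<open>b\<close>. Branches glued at a level from
  \<open>a + 1\<close> to \<open>L\<close> are both in this class or both outside; above
  \<open>L\<close> no two branches are glued.\<close>

lemma compat_cut:
  assumes "a \<le> b" "L \<le> b"
  shows "compat (\<lambda>h. if R (Suc a) k h then a else b)"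
  unfolding compat_def
proof (intro allI impI)
  fix i j l assume R: "R l i j"
  consider "l \<le> a" | "Suc a \<le> l" "l \<le> L" | "i = j"
    using R_L R_antimono[OF R, of L] by fastforce
  then show "l \<le> (if R (Suc a) k i then a else b) \<longleftrightarrow> l \<le> (if R (Suc a) k j then a else b)"
  proof cases
    case 2
    then have "R (Suc a) i j" using R_antimono[OF R] by blast
    then have "R (Suc a) k i \<longleftrightarrow> R (Suc a) k j" using R_trans R_sym by blast
    then show ?thesis by simp
  qed (use assms in auto)
qed

lemma compat_zero:
  assumes "compat d" "d i = 0" shows "d j = 0"
  using compat_eqD[OF assms(1), of i j] R_one assms(2) by simp

section \<open>The semigroup of compatible depths is Arf\<close>

lemma semigrpI: "compat d \<Longrightarrow> vec_of d \<in> semigrp"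
  by (simp add: semigrp_def)

lemma semigrpE:
  assumes "x \<in> semigrp" obtains d where "compat d" "x = vec_of d"
  using assms by (auto simp: semigrp_def)

lemma vec_of_le_iff: "vec_of d \<le> vec_of e \<longleftrightarrow> (\<forall>i. d i \<le> e i)"
  by (simp add: less_eq_vec_def)

lemma vec_of_inj: "vec_of d = vec_of e \<longleftrightarrow> d = e"
  by (auto simp: vec_eq_iff)

lemma zero_in_semigrp: "0 \<in> semigrp"
proof -
  have "0 = vec_of (\<lambda>_. 0)" by (simp add: vec_eq_iff)
  then show ?thesis using semigrpI[OF compat_const] by metis
qed

lemma vmin_in_semigrp:
  assumes "x \<in> semigrp" "y \<in> semigrp" shows "vmin x y \<in> semigrp"
proof -
  obtain d e where "compat d" "x = vec_of d" "compat e" "y = vec_of e"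
    using assms by (meson semigrpE)
  moreover have "vmin (vec_of d) (vec_of e) = vec_of (\<lambda>i. min (d i) (e i))"
    by (simp add: vmin_def vec_eq_iff height_min)
  ultimately show ?thesis by (simp add: semigrpI compat_min)
qed

lemma arf_in_semigrp:
  assumes "x \<in> semigrp" "y \<in> semigrp" "z \<in> semigrp" "z \<le> x" "z \<le> y"
  shows "x + y - z \<in> semigrp"
proof -
  obtain a b c where abc: "compat a" "compat b" "compat c" "x = vec_of a" "y = vec_of b" "z = vec_of c"
    using assms by (meson semigrpE)
  then have le: "c i \<le> a i" "c i \<le> b i" for i using assms vec_of_le_iff by blast+
  have "\<forall>i. \<exists>e. height i e + height i (c i) = height i (a i) + height i (b i)"
    using height_arf le by blast
  then obtain e where e: "\<And>i. height i (e i) + height i (c i) = height i (a i) + height i (b i)"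
    by metis
  \<comment> \<open>\<open>height_arf_compat\<close> takes one depth \<open>c\<close> for both
    branches. They share it if \<open>c i < l\<close>; otherwise \<open>e\<close> is at least
    \<open>l\<close> on both.\<close>
  have "min l (e i) = min l (e j)" if R: "R l i j" for i j l
  proof (cases "c i < l")
    case True
    have min: "min l (f i) = min l (f j)" if "f \<in> {a, b, c}" for f
      using that abc R unfolding compat_iff_min by blast
    then have "c j = c i" using min[of c] True by (auto simp: min_def split: if_splits)
    then show ?thesis
      using height_arf_compat[OF R, of "c i" "a i" "b i" "a j" "b j"] le[of i] le[of j] e[of i] e[of j]
        min[of a] min[of b] by simp
  next
    case False
    have "c i \<le> e i" "c j \<le> e j" using height_arf_ge[OF le(2) e] le(1) le_trans by blast+
    moreover have "l \<le> c j" using False compatD[OF abc(3) R] by simp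
    ultimately show ?thesis using False by simp
  qed
  then have "compat e" by (simp add: compat_iff_min)
  moreover have "x + y - z = vec_of e"
    using e abc by (auto simp: vec_eq_iff) (metis add_diff_cancel_right')
  ultimately show ?thesis by (simp add: semigrpI)
qed

text \<open>With \<open>\<mu>\<close> the smaller depth, \<open>y' k\<close> is the largest subtree
  of depth \<open>\<mu> k\<close> on \<open>k\<close> within the bound \<open>N\<close>. The minimum
  of the \<open>y' k\<close> over the branches where \<open>d\<close> and \<open>e\<close> differ is
  the element sought: it is at least \<open>\<mu>\<close>, equal to it on those branches, and above
  \<open>d i\<close> on \<open>i\<close>.\<close>

lemma semigrp_exchange:
  assumes "x \<in> semigrp" "y \<in> semigrp" "x \<noteq> y" "x $ i = y $ i"
  shows "\<exists>z\<in>semigrp. z $ i > x $ i \<and>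
           (\<forall>j. j \<noteq> i \<longrightarrow> z $ j \<ge> min (x $ j) (y $ j) \<and>
              (x $ j \<noteq> y $ j \<longrightarrow> z $ j = min (x $ j) (y $ j)))"
proof -
  obtain d e where de: "compat d" "x = vec_of d" "compat e" "y = vec_of e"
    using assms by (meson semigrpE)
  define \<mu> where "\<mu> k = min (d k) (e k)" for k
  define K where "K = {k. d k \<noteq> e k}"
  define N where "N = Suc (L + (\<Sum>k\<in>UNIV. d k))"
  define y' where "y' k h = (if R (Suc (\<mu> k)) k h then \<mu> k else N)" for k h
  define f where "f h = Min ((\<lambda>k. y' k h) ` K)" for h
  have dN: "d k < N" for k
  proof -
    have "d k \<le> (\<Sum>k\<in>UNIV. d k)" by (rule member_le_sum) auto
    then show ?thesis by (simp add: N_def)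
  qed
  have K: "finite K" "K \<noteq> {}" using assms(3) de by (auto simp: K_def vec_of_inj)
  \<comment> \<open>Whichever of \<open>d\<close> and \<open>e\<close> attains
    \<open>\<mu> k\<close> on \<open>k\<close> keeps this value on all branches glued to
    \<open>k\<close> one level further.\<close>
  have same: "d h = \<mu> k \<or> e h = \<mu> k" if "R (Suc (\<mu> k)) k h" for k h
    using that compat_eqD[OF de(1), of k h] compat_eqD[OF de(3), of k h]
    unfolding \<mu>_def by (auto simp: min_def split: if_splits)
  have ge: "\<mu> h \<le> y' k h" for k h
    using same[of k h] dN[of h] by (auto simp: y'_def \<mu>_def min_def split: if_splits)
  have big: "d i < y' k i" if "k \<in> K" for k
  proof -
    have "d i = e i" using assms(4) de by simp
    \<comment> \<open>Otherwise the common depth of \<open>d\<close> and \<open>e\<close> on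
      \<open>i\<close> would be \<open>\<mu> k\<close>, and would carry over to \<open>k\<close>,
      where they differ.\<close>
    have "\<not> R (Suc (\<mu> k)) k i"
    proof
      assume R: "R (Suc (\<mu> k)) k i"
      then have "\<mu> k = d i" using same \<open>d i = e i\<close> by metis
      then have "d k = d i" "e k = e i"
        using R R_sym compat_eqD[OF de(1), of i k] compat_eqD[OF de(3), of i k] \<open>d i = e i\<close> by auto
      then show False using that \<open>d i = e i\<close> by (simp add: K_def)
    qed
    then show ?thesis using dN by (simp add: y'_def)
  qed
  have "compat f" unfolding f_def
  proof (rule compat_Min[OF K])
    show "compat (y' k)" for k
      unfolding y'_def using dN[of k] by (intro compat_cut) (auto simp: \<mu>_def N_def)
  qed
  moreover have "d i < f i" using big K by (simp add: f_def)
  moreover have "\<mu> j \<le> f j" for j using ge K by (simp add: f_def)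
  moreover have "f j = \<mu> j" if "d j \<noteq> e j" for j
  proof (rule antisym)
    have "f j \<le> y' j j" using K that unfolding f_def by (intro Min_le) (auto simp: K_def)
    then show "f j \<le> \<mu> j" by (simp add: y'_def R_refl)
  qed fact
  ultimately show ?thesis
    using de semigrpI[of f]
    by (intro bexI[of _ "vec_of f"]) (auto simp: \<mu>_def height_min[symmetric])
qed

lemma good_semigrp: "good_semigroup semigrp"
proof -
  have "\<exists>\<delta>\<in>semigrp. \<forall>v. \<delta> + v \<in> semigrp"
  proof (intro bexI allI)
    show "vec_of (\<lambda>_. L) \<in> semigrp" by (rule semigrpI[OF compat_const])
    fix v :: "nat ^ 'n"
    have "vec_of (\<lambda>_. L) + v = vec_of (\<lambda>i. L + v $ i)"
      by (simp add: vec_eq_iff height_add_large)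
    then show "vec_of (\<lambda>_. L) + v \<in> semigrp" by (simp add: semigrpI compat_large)
  qed
  \<comment> \<open>Addition is the Arf operation with \<open>z = 0\<close>.\<close>
  moreover have "x + y \<in> semigrp" if "x \<in> semigrp" "y \<in> semigrp" for x y
    using arf_in_semigrp[OF that zero_in_semigrp] by (simp add: less_eq_vec_def)
  ultimately show ?thesis
    unfolding good_semigroup_def submonoid_of_vec_def
    by (intro conjI ballI allI impI zero_in_semigrp vmin_in_semigrp semigrp_exchange) simp_all
qed

lemma arf_semigrp: "arf_semigroup semigrp"
proof -
  have "local_semigroup semigrp"
    unfolding local_semigroup_def
    by (auto elim!: semigrpE simp: vec_eq_iff dest: compat_zero)
       (metis compat_zero height_0 height_eq_iff)
  moreover have "submonoid_of_vec {\<beta> - \<alpha> | \<beta>. \<beta> \<in> semigrp \<and> \<alpha> \<le> \<beta>}" if "\<alpha> \<in> semigrp" for \<alpha>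
    unfolding submonoid_of_vec_def
  proof (intro conjI ballI)
    show "0 \<in> {\<beta> - \<alpha> | \<beta>. \<beta> \<in> semigrp \<and> \<alpha> \<le> \<beta>}"
      using that by (force simp: vec_eq_iff)
    fix a b assume "a \<in> {\<beta> - \<alpha> | \<beta>. \<beta> \<in> semigrp \<and> \<alpha> \<le> \<beta>}" "b \<in> {\<beta> - \<alpha> | \<beta>. \<beta> \<in> semigrp \<and> \<alpha> \<le> \<beta>}"
    then obtain x y where xy: "x \<in> semigrp" "\<alpha> \<le> x" "a = x - \<alpha>" "y \<in> semigrp" "\<alpha> \<le> y" "b = y - \<alpha>"
      by blast
    have "\<alpha> $ i \<le> x $ i" "\<alpha> $ i \<le> y $ i" for i using xy by (auto simp: less_eq_vec_def)
    then have "a + b = (x + y - \<alpha>) - \<alpha>" "\<alpha> \<le> x + y - \<alpha>"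
      using xy by (auto simp: vec_eq_iff less_eq_vec_def add_le_mono le_diff_conv2 trans_le_add1)
    then show "a + b \<in> {\<beta> - \<alpha> | \<beta>. \<beta> \<in> semigrp \<and> \<alpha> \<le> \<beta>}"
      using arf_in_semigrp xy that by blast
  qed
  ultimately show ?thesis using good_semigrp by (simp add: arf_semigroup_def)
qed

section \<open>Separating the branches\<close>

text \<open>Everything is relative to \<open>A\<close>, so that families for disjoint classes can be
  assembled. By compatibility, the smaller depth in the last clause is the last level at which
  \<open>i\<close> and \<open>j\<close> are glued. The bound \<open>k\<close> ensures that a subtree
  entering a class goes beyond one cut below it.\<close>

definition separating :: "'n set \<Rightarrow> 'b set \<Rightarrow> nat \<Rightarrow> ('b \<Rightarrow> 'n \<Rightarrow> nat) \<Rightarrow> bool" where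
  "separating A B k d \<longleftrightarrow>
     (\<forall>p\<in>B. (\<forall>i\<in>A. k \<le> d p i) \<and> (\<forall>i\<in>A. \<forall>j\<in>A. \<forall>l. R l i j \<longrightarrow> (l \<le> d p i \<longleftrightarrow> l \<le> d p j))) \<and>
     (\<forall>i\<in>A. \<forall>j\<in>A. i \<noteq> j \<longrightarrow> (\<exists>p\<in>B. d p i \<noteq> d p j \<and> R (min (d p i) (d p j)) i j))"

text \<open>
  If \<open>g\<close> is the last level at which all branches in \<open>A\<close> are glued, they split into classes at level
  \<open>g + 1\<close>. The class \<open>c\<close> receives a set \<open>U c\<close> of subtrees that go on into it, all others being cut
  at level \<open>g\<close>. Two classes are separated as soon as these sets differ, and induction applies to \<open>c\<close>
  if it has at most \<open>2 ^ card (U c)\<close> branches.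
\<close>

lemma exists_separating:
  fixes B :: "'b set"
  assumes "finite B" "A \<noteq> {}" "card A \<le> 2 ^ card B" "\<forall>i\<in>A. \<forall>j\<in>A. R k i j"
  shows "\<exists>d. separating A B k d"
  using assms
proof (induction "card A" arbitrary: A B k rule: less_induct)
  case less
  show ?case
  proof (cases "\<exists>i\<in>A. \<exists>j\<in>A. i \<noteq> j")
    case False
    then show ?thesis
      by (intro exI[of _ "\<lambda>_ _. k"]) (auto simp: separating_def)
  next
    case True
    define P where "P l \<longleftrightarrow> (\<forall>i\<in>A. \<forall>j\<in>A. R l i j)" for l
    \<comment> \<open>Such a level exists because distinct branches are no longer glued at level
      \<open>L\<close>.\<close>
    have "\<exists>g\<ge>k. P g \<and> \<not> P (Suc g)"
    proof (rule ccontr)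
      assume "\<not> ?thesis"
      then have "P (max k L)"
        using less.prems(4) by (intro dec_induct[of k "max k L" P]) (auto simp: P_def)
      then show False
        using True R_L R_antimono[of "max k L" _ _ L] unfolding P_def by (metis max.cobounded2)
    qed
    then obtain g where g: "k \<le> g" "P g" "\<not> P (Suc g)" by blast
    define cl where "cl i = {j\<in>A. R (Suc g) i j}" for i
    have cl_eq: "cl i = cl j \<longleftrightarrow> R (Suc g) i j" if "j \<in> A" for i j
      using that R_refl R_sym R_trans unfolding cl_def by blast
    have cl_self: "i \<in> cl i" if "i \<in> A" for i using that R_refl by (simp add: cl_def)
    have clR: "R (Suc g) a b" if "a \<in> cl i" "b \<in> cl i" for a b i
      using that R_sym R_trans unfolding cl_def by blast
    have small: "cl i \<subset> A" for i
    proof -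
      have "cl i \<noteq> A" using g(3) clR[of _ i] unfolding P_def by blast
      then show ?thesis by (auto simp: cl_def)
    qed
    have "card A = card (\<Union>(cl ` A))"
      using cl_self by (intro arg_cong[of _ _ card]) (auto simp: cl_def)
    also have "\<dots> = sum card (cl ` A)"
    proof (rule card_Union_disjoint)
      show "pairwise disjnt (cl ` A)"
        using R_sym R_trans unfolding pairwise_def disjnt_def cl_def by blast
    qed simp
    finally have "sum card (cl ` A) \<le> 2 ^ card B" using less.prems(3) by simp
    moreover have "0 < card c" if "c \<in> cl ` A" for c
      using that cl_self by (auto simp: card_gt_0_iff)
    ultimately obtain U where U: "inj_on U (cl ` A)" "\<forall>c\<in>cl ` A. U c \<subseteq> B \<and> card c \<le> 2 ^ card (U c)"
      using exists_distinct_codes[of "cl ` A" B card] less.prems(1) by auto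
    have "\<forall>c\<in>cl ` A. \<exists>d. separating c (U c) (Suc g) d"
    proof
      fix c assume c: "c \<in> cl ` A"
      then have "card c < card A" using small by (auto intro!: psubset_card_mono)
      moreover have "finite (U c)" using U c less.prems(1) finite_subset by blast
      moreover have "c \<noteq> {}" using c cl_self by blast
      moreover have "\<forall>i\<in>c. \<forall>j\<in>c. R (Suc g) i j" using c clR by blast
      ultimately show "\<exists>d. separating c (U c) (Suc g) d" using less.hyps U c by blast
    qed
    then obtain D where D: "\<forall>c\<in>cl ` A. separating c (U c) (Suc g) (D c)" by metis
    define d where "d p i = (if p \<in> U (cl i) then D (cl i) p i else g)" for p i
    have D_ge: "Suc g \<le> D (cl i) p i" if "i \<in> A" "p \<in> U (cl i)" for i p
      using D that cl_self[OF that(1)] unfolding separating_def by blast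
    have D_sep: "\<exists>p\<in>U (cl i). D (cl i) p i \<noteq> D (cl i) p j \<and> R (min (D (cl i) p i) (D (cl i) p j)) i j"
      if "i \<in> A" "i \<in> cl i" "j \<in> cl i" "i \<noteq> j" for i j
    proof -
      have "separating (cl i) (U (cl i)) (Suc g) (D (cl i))" using D that by blast
      from this[unfolded separating_def, THEN conjunct2] show ?thesis using that by blast
    qed
    have d_ge: "g \<le> d p i" if "i \<in> A" for i p using D_ge[OF that, of p] by (auto simp: d_def)
    have "l \<le> d p i \<longleftrightarrow> l \<le> d p j" if ij: "i \<in> A" "j \<in> A" "R l i j" for p i j l
    proof (cases "cl i = cl j")
      case True
      then have "i \<in> cl i" "j \<in> cl i" using cl_self ij by auto
      have sep: "separating (cl i) (U (cl i)) (Suc g) (D (cl i))" using D ij by blast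
      show ?thesis
      proof (cases "p \<in> U (cl i)")
        case p: True
        have "l \<le> D (cl i) p i \<longleftrightarrow> l \<le> D (cl i) p j"
          using sep[unfolded separating_def, THEN conjunct1] p \<open>i \<in> cl i\<close> \<open>j \<in> cl i\<close> ij(3) by blast
        then show ?thesis using True p by (simp add: d_def)
      next
        case False
        then show ?thesis using True by (simp add: d_def)
      qed
    next
      case False
      then have "l \<le> g" using cl_eq ij R_antimono[OF ij(3), of "Suc g"] by force
      then show ?thesis using d_ge ij le_trans by blast
    qed
    moreover have "\<exists>p\<in>B. d p i \<noteq> d p j \<and> R (min (d p i) (d p j)) i j"
      if ij: "i \<in> A" "j \<in> A" "i \<noteq> j" for i j
    proof (cases "cl i = cl j")
      case True
      then have "i \<in> cl i" "j \<in> cl i" using cl_self ij by auto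
      then obtain p where "p \<in> U (cl i)" "D (cl i) p i \<noteq> D (cl i) p j"
        "R (min (D (cl i) p i) (D (cl i) p j)) i j"
        using D_sep ij by blast
      then show ?thesis using True U ij by (intro bexI[of _ p]) (auto simp: d_def)
    next
      case False
      then have "U (cl i) \<noteq> U (cl j)" using U ij unfolding inj_on_def by blast
      then obtain p where p: "p \<in> U (cl i) \<and> p \<notin> U (cl j) \<or> p \<notin> U (cl i) \<and> p \<in> U (cl j)" by blast
      then have "p \<in> B" using U ij by blast
      have "d p i \<noteq> d p j" "min (d p i) (d p j) = g"
        using p D_ge[OF ij(1), of p] D_ge[OF ij(2), of p] by (auto simp: d_def)
      then show ?thesis using \<open>p \<in> B\<close> g(2) ij unfolding P_def by metis
    qed
    moreover have "k \<le> d p i" if "i \<in> A" for p i using d_ge[OF that] g(1) le_trans by blast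
    ultimately show ?thesis unfolding separating_def by blast
  qed
qed

section \<open>Generation\<close>

lemma exists_depth:
  assumes S: "arf_semigroup S"
    and chars: "\<And>i j. 1 \<le> j \<Longrightarrow> (\<forall>q\<ge>1. s i q \<noteq> j) \<Longrightarrow> \<exists>d. compat d \<and> vec_of d \<in> S \<and> d i = j"
  shows "\<exists>d. compat d \<and> vec_of d \<in> S \<and> d i = j"
proof (induction j rule: less_induct)
  case (less j)
  have good: "good_semigroup S" using S by (simp add: arf_semigroup_def)
  have min: "vmin x y \<in> S" if "x \<in> S" "y \<in> S" for x y
    using good_semigroup_vmin[OF good that] .
  consider "j = 0" | "1 \<le> j" "\<forall>q\<ge>1. s i q \<noteq> j" | q where "1 \<le> q" "s i q = j" by fastforce
  then show ?case
  proof cases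
    case 1
    have "vec_of (\<lambda>_. 0) = 0" by (simp add: vec_eq_iff)
    moreover have "0 \<in> S"
      using good by (simp add: good_semigroup_def submonoid_of_vec_def)
    ultimately show ?thesis using 1 compat_const by (intro exI[of _ "\<lambda>_. 0"]) auto
  next
    case 2
    then show ?thesis by (rule chars)
  next
    case 3
    then obtain r where r: "q = Suc r" by (cases q) auto
    then have "Suc r < j" using s_gt 3 by blast
    then obtain a b where a: "compat a" "vec_of a \<in> S" "a i = Suc r"
      and b: "compat b" "vec_of b \<in> S" "b i = r"
      using less.IH by (meson Suc_lessD)
    \<comment> \<open>The \<open>vmin\<close> lies below \<open>vec_of a\<close> and still has depth
      \<open>r\<close> on \<open>i\<close>; there \<open>x\<close> is \<open>2 y - z\<close> with
      \<open>y\<close>, \<open>z\<close> of depths \<open>q\<close> and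
      \<open>q - 1\<close>.\<close>
    define x where "x = vec_of a + vec_of a - vmin (vec_of a) (vec_of b)"
    have le: "vmin (vec_of a) (vec_of b) \<le> vec_of a" by (simp add: vmin_def less_eq_vec_def)
    then have "x \<in> semigrp" unfolding x_def
      using a b by (intro arf_in_semigrp vmin_in_semigrp semigrpI)
    then obtain d where d: "compat d" "x = vec_of d" by (rule semigrpE)
    have "x \<in> S" unfolding x_def by (intro arf_semigroupD[OF S] min a b le)
    moreover have "x $ i = height i j"
      using 3 r height_stop[of i r] a b by (simp add: x_def vmin_def)
    ultimately show ?thesis using d by auto
  qed
qed

text \<open>
  An element of depth \<open>j\<close> on the branch \<open>i\<close> has depth \<open>j\<close> on all branches glued to \<open>i\<close> at level
  \<open>j + 1\<close>. Its other components can be raised one at a time without changing these: a separating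
  subtree either supplies a difference \<open>\<beta> - \<alpha>\<close> that is positive at \<open>h\<close> only, or one that vanishes at
  \<open>h\<close> only, and then the exchange property is applied at \<open>h\<close>.
\<close>

lemma semigrp_subset:
  assumes S: "arf_semigroup S"
    and depth: "\<And>i j. \<exists>d. compat d \<and> vec_of d \<in> S \<and> d i = j"
    and sep: "\<And>i h. i \<noteq> h \<Longrightarrow> \<exists>w. compat w \<and> vec_of w \<in> S \<and> w i \<noteq> w h \<and> R (min (w i) (w h)) i h"
  shows "semigrp \<subseteq> S"
proof -
  have good: "good_semigroup S" using S by (simp add: arf_semigroup_def)
  have min: "vmin x y \<in> S" if "x \<in> S" "y \<in> S" for x y
    using good_semigroup_vmin[OF good that] .
  \<comment> \<open>An element of \<open>semigrp\<close> will be the minimum over \<open>i\<close>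
    of such elements, with \<open>j\<close> its depth on \<open>i\<close>.\<close>
  have far: "\<exists>x\<in>S. (\<forall>b. R (Suc j) i b \<longrightarrow> x $ b = height b j) \<and> (\<forall>h. \<not> R (Suc j) i h \<longrightarrow> N \<le> x $ h)"
    for i j N
  proof -
    \<comment> \<open>The last clause keeps component \<open>h\<close> at or above every level that
      \<open>h\<close> shares with \<open>i\<close>; this serves to evaluate \<open>\<alpha>\<close>
      at \<open>h\<close> when \<open>w\<close> ends there first.\<close>
    define I where "I x \<longleftrightarrow> x \<in> S \<and> (\<forall>b. R (Suc j) i b \<longrightarrow> x $ b = height b j) \<and>
      (\<forall>h g. \<not> R (Suc j) i h \<longrightarrow> R g i h \<longrightarrow> height h g \<le> x $ h)" for x
    have I_le: "I y" if "I x" "y \<in> S" "x \<le> y" "\<And>b. R (Suc j) i b \<Longrightarrow> y $ b = x $ b" for x y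
      unfolding I_def
    proof (intro conjI allI impI)
      show "y \<in> S" by fact
      show "y $ b = height b j" if "R (Suc j) i b" for b
        using \<open>I x\<close> \<open>\<And>b. R (Suc j) i b \<Longrightarrow> y $ b = x $ b\<close>[OF that] that by (simp add: I_def)
      show "height h g \<le> y $ h" if "\<not> R (Suc j) i h" "R g i h" for h g
      proof -
        have "height h g \<le> x $ h" using \<open>I x\<close> that by (simp add: I_def)
        also have "\<dots> \<le> y $ h" using \<open>x \<le> y\<close> by (simp add: less_eq_vec_def)
        finally show ?thesis .
      qed
    qed
    have raise: "\<exists>y. I y \<and> x \<le> y \<and> x $ h < y $ h" if x: "I x" and h: "\<not> R (Suc j) i h" for x h
    proof -
      have "i \<noteq> h" using h R_refl by blast
      then obtain w where w: "compat w" "vec_of w \<in> S" "w i \<noteq> w h" "R (min (w i) (w h)) i h"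
        using sep by blast
      define g where "g = min (w i) (w h)"
      have g: "R g i h" using w(4) by (simp add: g_def)
      have "g \<le> j" using g h R_antimono[of g i h "Suc j"] by force
      have xh: "height h g \<le> x $ h" using x h g by (simp add: I_def)
      have xb: "x $ b = height b j" if "R (Suc j) i b" for b using x that by (simp add: I_def)
      have Rb: "R (Suc g) i b" "R g i b" if "R (Suc j) i b" for b
        using R_antimono[OF that] \<open>g \<le> j\<close> by simp_all
      \<comment> \<open>\<open>u z\<close> exceeds \<open>x\<close> exactly in those components
        where \<open>x\<close> or \<open>z\<close> is below \<open>vec_of w\<close>.\<close>
      define \<alpha> where "\<alpha> z = vmin (vmin x (vec_of w)) z" for z
      define u where "u z = x + vec_of w - \<alpha> z" for z
      have \<alpha>_le: "\<alpha> z \<le> x" "\<alpha> z \<le> vec_of w" for z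
        by (auto simp: \<alpha>_def vmin_def less_eq_vec_def)
      have u_S: "u z \<in> S" if "z \<in> S" for z
        unfolding u_def using that x w \<alpha>_le
        by (intro arf_semigroupD[OF S]) (auto simp: \<alpha>_def I_def intro!: min)
      have u_nth: "u z $ l = x $ l + (height l (w l) - \<alpha> z $ l)" for z l
        using \<alpha>_le(2)[of z] by (simp add: u_def less_eq_vec_def)
      have x_le: "x \<le> u z" for z by (simp add: less_eq_vec_def u_nth)
      show ?thesis
      proof (cases "w i = g")
        case True
        then have wb: "w b = g" if "R (Suc j) i b" for b using compat_eqD[OF w(1), of i b] Rb[OF that] by simp
        have wh: "g < w h" using True w(3) by (simp add: g_def)
        \<comment> \<open>Here \<open>w\<close> ends at \<open>g\<close> on the class of
          \<open>i\<close> and goes further on \<open>h\<close>. With \<open>d\<close> of depth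
          \<open>g\<close> on \<open>h\<close>, component \<open>h\<close> is raised and the class
          is unchanged.\<close>
        obtain d where d: "compat d" "vec_of d \<in> S" "d h = g" using depth by blast
        have db: "g \<le> d b" if "R (Suc j) i b" for b
        proof -
          have "R g h b" using R_sym[OF g] Rb(2)[OF that] R_trans by blast
          then show ?thesis using compatD[OF d(1)] d(3) by blast
        qed
        let ?y = "u (vec_of d)"
        have "\<alpha> (vec_of d) $ b = height b (w b)" if "R (Suc j) i b" for b
          using wb[OF that] db[OF that] xb[OF that] \<open>g \<le> j\<close> by (simp add: \<alpha>_def vmin_def)
        then have "?y $ b = x $ b" if "R (Suc j) i b" for b using that by (simp add: u_nth)
        then have "I ?y" using I_le[OF x u_S[OF d(2)] x_le] by blast
        moreover have "\<alpha> (vec_of d) $ h < height h (w h)"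
          using wh d(3) by (simp add: \<alpha>_def vmin_def min.strict_coboundedI2)
        ultimately show ?thesis using x_le by (intro exI[of _ ?y]) (simp add: u_nth)
      next
        case False
        then have wh: "w h = g" "g < w i" using w(3) by (auto simp: g_def min_def split: if_splits)
        then have wb: "g < w b" if "R (Suc j) i b" for b
          using compatD[OF w(1) Rb(1)[OF that]] by (simp add: Suc_le_eq)
        \<comment> \<open>Here \<open>w\<close> ends at \<open>g\<close> on \<open>h\<close> and
          goes further on the class. With \<open>d\<close> of depth \<open>g\<close> on
          \<open>i\<close>, the class is raised and \<open>h\<close> is unchanged; exchange at
          \<open>h\<close> then raises \<open>h\<close> and takes the class back to
          \<open>x\<close>.\<close>
        obtain d where d: "compat d" "vec_of d \<in> S" "d i = g" using depth by blast
        have db: "d b = g" if "R (Suc j) i b" for b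
          using compat_eqD[OF d(1), of i b] d(3) Rb[OF that] by simp
        have dh: "g \<le> d h" using compatD[OF d(1) g] d(3) by simp
        let ?u = "u (vec_of d)"
        have "\<alpha> (vec_of d) $ h = height h g" using wh dh xh by (simp add: \<alpha>_def vmin_def)
        then have uh: "x $ h = ?u $ h" using wh by (simp add: u_nth)
        have "\<alpha> (vec_of d) $ b < height b (w b)" if "R (Suc j) i b" for b
          using wb[OF that] db[OF that] by (simp add: \<alpha>_def vmin_def min.strict_coboundedI2)
        then have ub: "x $ b < ?u $ b" if "R (Suc j) i b" for b using that by (simp add: u_nth)
        have "x \<noteq> ?u" using ub[OF R_refl] by auto
        moreover have "x \<in> S" using x by (simp add: I_def)
        ultimately obtain c where c: "c \<in> S" "x $ h < c $ h"
          "\<forall>l. l \<noteq> h \<longrightarrow> min (x $ l) (?u $ l) \<le> c $ l \<and> (x $ l \<noteq> ?u $ l \<longrightarrow> c $ l = min (x $ l) (?u $ l))"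
          using good_semigroup_exchange[OF good _ u_S[OF d(2)] _ uh] by metis
        have min_u: "min (x $ l) (?u $ l) = x $ l" for l using x_le[of "vec_of d"] by (simp add: less_eq_vec_def)
        have "x \<le> c" unfolding less_eq_vec_def using c min_u by (metis less_imp_le)
        moreover have "c $ b = x $ b" if "R (Suc j) i b" for b
          using c(3) min_u[of b] ub[OF that] h that by (metis less_irrefl)
        ultimately show ?thesis using I_le[OF x c(1)] c(2) by blast
      qed
    qed
    have raise': "\<exists>y. I y \<and> x \<le> y \<and> k \<le> y $ h" if x: "I x" and h: "\<not> R (Suc j) i h" for x h k
    proof (induction k)
      case 0
      then show ?case using x by auto
    next
      case (Suc k)
      then obtain y where y: "I y" "x \<le> y" "k \<le> y $ h" by blast
      with raise[OF y(1) h] show ?case by (meson Suc_leI le_less_trans order_trans)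
    qed
    have "\<exists>x. I x \<and> (\<forall>h\<in>H. \<not> R (Suc j) i h \<longrightarrow> N \<le> x $ h)" for H
      using finite[of H]
    proof (induction H rule: finite_induct)
      case empty
      obtain d where d: "compat d" "vec_of d \<in> S" "d i = j" using depth by blast
      have "height h g \<le> height h (d h)" if "\<not> R (Suc j) i h" "R g i h" for h g
      proof -
        have "g \<le> d i" using that d(3) R_antimono[OF that(2), of "Suc j"] by force
        then show ?thesis using compatD[OF d(1) that(2)] by simp
      qed
      moreover have "d b = j" if "R (Suc j) i b" for b using compat_eqD[OF d(1), of i b] d(3) that by simp
      ultimately have "I (vec_of d)" using d(2) by (simp add: I_def)
      then show ?case by blast
    next
      case (insert h H)
      then obtain x where x: "I x" "\<forall>h\<in>H. \<not> R (Suc j) i h \<longrightarrow> N \<le> x $ h" by blast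
      show ?case
      proof (cases "R (Suc j) i h")
        case True
        then show ?thesis using x by auto
      next
        case False
        then obtain y where "I y" "x \<le> y" "N \<le> y $ h" using raise' x by blast
        then show ?thesis using x by (intro exI[of _ y]) (auto simp: less_eq_vec_def intro: order_trans)
      qed
    qed
    from this[of UNIV] show ?thesis unfolding I_def by blast
  qed
  show ?thesis
  proof
    fix x assume "x \<in> semigrp"
    then obtain d where d: "compat d" "x = vec_of d" by (rule semigrpE)
    define N where "N = (\<Sum>h\<in>UNIV. height h (d h))"
    have N: "height h (d h) \<le> N" for h unfolding N_def by (rule member_le_sum) auto
    obtain y where y: "\<And>i. y i \<in> S" "\<And>i b. R (Suc (d i)) i b \<Longrightarrow> y i $ b = height b (d i)"
      "\<And>i h. \<not> R (Suc (d i)) i h \<Longrightarrow> N \<le> y i $ h"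
      using far[of "d i" i N for i] by metis
    \<comment> \<open>\<open>y h\<close> attains this value. Any other \<open>y i\<close> is at
      least as large at \<open>h\<close>: either \<open>h\<close> is glued to \<open>i\<close>
      beyond level \<open>d i\<close>, so that \<open>d h = d i\<close>, or the component is at
      least \<open>N\<close>.\<close>
    have "Min (range (\<lambda>i. y i $ h)) = height h (d h)" for h
    proof (rule Min_eqI)
      show "height h (d h) \<in> range (\<lambda>i. y i $ h)" using y(2)[of h h] R_refl by (metis rangeI)
      fix t assume "t \<in> range (\<lambda>i. y i $ h)"
      then obtain i where t: "t = y i $ h" by blast
      show "height h (d h) \<le> t"
      proof (cases "R (Suc (d i)) i h")
        case True
        then show ?thesis using y(2) compat_eqD[OF d(1)] t by simp
      next
        case False
        then show ?thesis using y(3) N t le_trans by blast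
      qed
    qed simp
    then have "(\<chi> h. Min (range (\<lambda>i. y i $ h))) = x" by (simp add: d vec_eq_iff)
    then show "x \<in> S" using Min_in_good_semigroup[OF good, of UNIV y] y(1) by simp
  qed
qed

section \<open>Restriction numbers and characters\<close>

lemma restriction_number_eq:
  "restriction_number (m i) j = card {q. 1 \<le> q \<and> q < j \<and> j \<le> s i q}"
  unfolding restriction_number_def by (intro arg_cong[of _ _ card]) (auto simp: stop_eq)

lemma restriction_number_glued:
  "R l i h \<Longrightarrow> restriction_number (m i) l = restriction_number (m h) l"
  unfolding restriction_number_eq by (intro arg_cong[of _ _ card]) (auto simp: s_level)

text \<open>Membership of \<open>j\<close> compares levels \<open>j\<close> and
  \<open>j + 1\<close>; for \<open>j < l\<close> the branches are glued at both.\<close>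

lemma PChar_glued:
  assumes "R l i h" "j < l"
  shows "j \<in> PChar (m i) \<longleftrightarrow> j \<in> PChar (m h)"
proof -
  have "R j i h" "R (j + 1) i h" using assms R_antimono by simp_all
  then show ?thesis by (simp add: PChar_def restriction_number_glued)
qed

text \<open>From level \<open>j\<close> to \<open>j + 1\<close> the count gains \<open>q = j\<close>
  and loses the \<open>q\<close> with stop \<open>j\<close>; without such a \<open>q\<close> it
  grows.\<close>

lemma not_stop_PChar:
  assumes "1 \<le> j" "\<forall>q\<ge>1. s i q \<noteq> j"
  shows "j \<in> PChar (m i)"
proof -
  have "{q. 1 \<le> q \<and> q < j + 1 \<and> j + 1 \<le> s i q} = insert j {q. 1 \<le> q \<and> q < j \<and> j \<le> s i q}"
    using assms s_gt[of j i] by (force simp: Suc_le_eq le_less)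
  then show ?thesis using assms by (simp add: PChar_def restriction_number_eq)
qed

text \<open>Once the multiplicities are \<open>1\<close>, the stop of \<open>q\<close> is
  \<open>q + 1\<close>, so from \<open>j = q + 1\<close> to \<open>j + 1\<close> the gain of
  \<open>j\<close> is offset by the loss of \<open>q\<close>.\<close>

lemma finite_PChar: "finite (PChar (m i))"
proof (rule finite_subset)
  show "PChar (m i) \<subseteq> {..L + 1}"
  proof
    fix j assume j: "j \<in> PChar (m i)"
    show "j \<in> {..L + 1}"
    proof (rule ccontr)
      assume "j \<notin> {..L + 1}"
      then obtain q where q: "j = Suc q" "1 \<le> q" "L \<le> q" by (cases j) auto
      have "1 = m i q" using m_one[OF q(3)] by simp
      also have "\<dots> = (\<Sum>k=q+1..s i q. m i k)" by (rule m_sum[OF q(2)])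
      also have "\<dots> = (\<Sum>k=q+1..s i q. 1)" using q(3) by (intro sum.cong) (auto simp: m_one)
      also have "\<dots> = s i q - q" by simp
      finally have s: "s i q = j" using q(1) by simp
      let ?Q = "{q. 1 \<le> q \<and> q < j \<and> j \<le> s i q}"
      have "{q. 1 \<le> q \<and> q < j + 1 \<and> j + 1 \<le> s i q} \<subseteq> insert j (?Q - {q})" using s by auto
      then have "restriction_number (m i) (j + 1) \<le> card (insert j (?Q - {q}))"
        unfolding restriction_number_eq by (intro card_mono) auto
      also have "\<dots> = Suc (card (?Q - {q}))" by (rule card_insert_disjoint) auto
      also have "\<dots> = card ?Q" using q s by (intro card_Suc_Diff1) auto
      finally show False using j by (simp add: PChar_def restriction_number_eq)
    qed
  qed
qed simp

text \<open>Supplies the elements that pad a generating set to the exact cardinality.\<close>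

lemma infinite_semigrp: "infinite semigrp"
proof -
  have "inj (\<lambda>c. vec_of (\<lambda>_. c))"
    by (rule injI) (simp add: vec_of_inj fun_eq_iff)
  then have "infinite (range (\<lambda>c. vec_of (\<lambda>_. c)))" by (rule range_inj_infinite)
  moreover have "range (\<lambda>c. vec_of (\<lambda>_. c)) \<subseteq> semigrp"
    using semigrpI[OF compat_const] by blast
  ultimately show ?thesis using finite_subset by blast
qed

lemma exists_generators:
  "\<exists>G. is_Arf G semigrp \<and> finite G \<and> card G = C_num m + nat \<lceil>log 2 (real CARD('n))\<rceil>"
proof -
  define C where "C = C_num m"
  define b where "b = nat \<lceil>log 2 (real CARD('n))\<rceil>"
  have C: "card (PChar (m i)) \<le> C" for i
    unfolding C_def C_num_def by (rule Max_ge) auto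
  obtain N where N: "\<And>i j. j \<in> PChar (m i) \<Longrightarrow> j < N"
  proof -
    have "finite (\<Union>i. PChar (m i))" using finite_PChar by simp
    then show ?thesis using that unfolding finite_nat_set_iff_bounded by blast
  qed
  \<comment> \<open>\<open>v t i\<close> is the character of branch \<open>i\<close> preceded by
    exactly \<open>t\<close> others, or \<open>N\<close>, which is beyond all characters, if there
    is none.\<close>
  define P where "P t i j \<longleftrightarrow> t < card (PChar (m i) \<inter> {..j}) \<or> N \<le> j" for t i j
  define v where "v t i = (LEAST j. P t i j)" for t i
  have v: "compat (v t)" for t
    unfolding compat_def
  proof (intro allI impI)
    fix i h l assume R: "R l i h"
    have "PChar (m i) \<inter> {..j} = PChar (m h) \<inter> {..j}" if "j < l" for j
      using PChar_glued[OF R] that by (auto intro: le_less_trans)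
    then have "P t i j \<longleftrightarrow> P t h j" if "j < l" for j using that by (simp add: P_def)
    moreover have "P t i N" "P t h N" by (simp_all add: P_def)
    ultimately show "l \<le> v t i \<longleftrightarrow> l \<le> v t h" by (simp add: v_def le_Least_iff)
  qed
  have v_eq: "\<exists>t<C. v t i = j" if j: "j \<in> PChar (m i)" for i j
  proof (intro exI conjI)
    let ?t = "card (PChar (m i) \<inter> {..<j})"
    have "PChar (m i) \<inter> {..<j} \<subset> PChar (m i)" using j by auto
    then have "?t < card (PChar (m i))" by (intro psubset_card_mono finite_PChar)
    then show "?t < C" using C[of i] by simp
    have "PChar (m i) \<inter> {..<j} \<subset> PChar (m i) \<inter> {..j}" using j by auto
    then have "P ?t i j" unfolding P_def by (intro disjI1 psubset_card_mono) auto
    moreover have "\<not> P ?t i k" if "k < j" for k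
    proof -
      have "card (PChar (m i) \<inter> {..k}) \<le> ?t" using that by (intro card_mono) auto
      then show ?thesis using N[OF j] that by (simp add: P_def)
    qed
    ultimately show "v ?t i = j" unfolding v_def by (intro Least_equality) (auto simp: not_less[symmetric])
  qed
  have "log 2 (real CARD('n)) \<le> real b" unfolding b_def by linarith
  then have "real CARD('n) \<le> 2 powr real b" by (simp add: log_le_iff)
  then have "real CARD('n) \<le> real (2 ^ b)" by (simp add: powr_realpow)
  then have "CARD('n) \<le> 2 ^ card {..<b}" by (simp only: of_nat_le_iff card_lessThan)
  then obtain d where d: "separating (UNIV :: 'n set) {..<b} 1 d"
    using exists_separating[of "{..<b}" "UNIV :: 'n set" 1] R_one by auto
  have d_compat: "compat (d p)" if "p < b" for p
    using d[unfolded separating_def, THEN conjunct1] that unfolding compat_def by simp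
  have d_sep: "\<exists>p<b. d p i \<noteq> d p j \<and> R (min (d p i) (d p j)) i j" if "i \<noteq> j" for i j
    using d[unfolded separating_def, THEN conjunct2] that by auto
  define G where "G = (\<lambda>t. vec_of (v t)) ` {..<C} \<union> (\<lambda>p. vec_of (d p)) ` {..<b}"
  have G: "finite G" "G \<subseteq> semigrp"
    using semigrpI v d_compat by (auto simp: G_def)
  have "card G \<le> C + b"
    unfolding G_def using card_Un_le card_image_le[of "{..<C}"] card_image_le[of "{..<b}"]
    by (metis (no_types, lifting) add_mono card_lessThan finite_lessThan le_trans)
  \<comment> \<open>Generators may coincide; further elements of \<open>semigrp\<close> restore the
    cardinality without enlarging what is generated.\<close>
  obtain X where X: "finite X" "card X = C + b - card G" "X \<subseteq> semigrp - G"
    using infinite_arbitrarily_large[of "semigrp - G"] infinite_semigrp G(1) by auto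
  have "semigrp \<subseteq> S" if S: "arf_semigroup S" "G \<subseteq> S" for S
  proof (rule semigrp_subset[OF S(1)])
    fix i j
    show "\<exists>d. compat d \<and> vec_of d \<in> S \<and> d i = j"
    proof (rule exists_depth[OF S(1)])
      fix i j assume "1 \<le> j" "\<forall>q\<ge>1. s i q \<noteq> j"
      then obtain t where "t < C" "v t i = j" using v_eq not_stop_PChar by blast
      then show "\<exists>d. compat d \<and> vec_of d \<in> S \<and> d i = j"
        using v S(2) by (intro exI[of _ "v t"]) (auto simp: G_def)
    qed
  next
    fix i h :: 'n assume "i \<noteq> h"
    then obtain p where "p < b" "d p i \<noteq> d p h" "R (min (d p i) (d p h)) i h" using d_sep by blast
    then show "\<exists>w. compat w \<and> vec_of w \<in> S \<and> w i \<noteq> w h \<and> R (min (w i) (w h)) i h"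
      using d_compat S(2) by (intro exI[of _ "d p"]) (auto simp: G_def)
  qed
  then have "is_Arf (G \<union> X) semigrp"
    using arf_semigrp G(2) X(3) by (auto simp: is_Arf_def)
  moreover have "card (G \<union> X) = C + b"
    using G X \<open>card G \<le> C + b\<close> by (subst card_Un_disjoint) auto
  ultimately show ?thesis using G(1) X(1) unfolding C_def b_def by blast
qed

end

section \<open>The gluing tree of a multiplicity tree\<close>

locale multiplicity_tree =
  fixes E :: "'n::finite \<Rightarrow> nat \<Rightarrow> nat" and T :: "'n mtree"
  assumes mult: "multiplicity_sequence (E i)"
    and tau: "T \<in> tau_trees E"
begin

text \<open>Level \<open>0\<close> is declared to glue all branches, so that gluing is antimonotone
  from level \<open>0\<close> on, as \<open>R_antimono\<close> asks.\<close>

definition glued_at :: "nat \<Rightarrow> 'n \<Rightarrow> 'n \<Rightarrow> bool" where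
  "glued_at l i j \<longleftrightarrow> l = 0 \<or> (i, j) \<in> glued T l"

lemma tree: "is_tree T"
  using tau by (simp add: tau_trees_def)

lemma glued_equiv: "1 \<le> l \<Longrightarrow> equiv UNIV (glued T l)"
  using tree by (simp add: is_tree_def)

lemma node_eq_iff: "1 \<le> l \<Longrightarrow> node T i l = node T j l \<longleftrightarrow> glued_at l i j"
  using eq_equiv_class_iff[OF glued_equiv] by (simp add: node_def glued_at_def)

lemma node_eq_levelD: "node T i k = node T j l \<Longrightarrow> k = l"
  by (simp add: node_def)

lemma glued_at_refl: "glued_at l i i"
  and glued_at_sym: "glued_at l i j \<Longrightarrow> glued_at l j i"
  and glued_at_trans: "glued_at l i j \<Longrightarrow> glued_at l j h \<Longrightarrow> glued_at l i h"
  using node_eq_iff[of l] by (cases "l = 0"; simp add: glued_at_def; metis)+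

lemma glued_at_antimono:
  assumes "glued_at l i j" "k \<le> l" shows "glued_at k i j"
  using assms(2,1)
proof (induction l rule: dec_induct)
  case (step n)
  have "glued_at n i j"
    using step.prems tree unfolding glued_at_def is_tree_def by (cases n) auto
  then show ?case by (rule step.IH)
qed

lemma label_nth: "1 \<le> l \<Longrightarrow> label T (node T i l) $ i = E i l"
  using tau by (simp add: tau_trees_def)

lemma label_zero_iff: "1 \<le> l \<Longrightarrow> label T (node T i l) $ h = 0 \<longleftrightarrow> node T i l \<noteq> node T h l"
  using tau by (simp add: tau_trees_def)

lemma is_stop_iff: "1 \<le> q \<Longrightarrow> is_stop (E i) q t \<longleftrightarrow> t = stop (E i) q"
  using mult[of i] unfolding multiplicity_sequence_def stop_def
  by (metis the_equality)

section \<open>Finite subtrees along a branch\<close>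

lemma subtree_nodeE:
  assumes "finite_subtree T (node T i r) V" "1 \<le> r" "v \<in> V"
  obtains h l where "1 \<le> l" "v = node T h l"
proof (cases "v = node T i r")
  case False
  then obtain h l where "v = node T h (l + 1)" using assms unfolding finite_subtree_def by blast
  then show ?thesis using that[of "l + 1" h] by simp
qed (use that assms in blast)

lemma subtree_parent:
  assumes "finite_subtree T (node T i r) V" "1 \<le> r" "node T h (Suc l) \<in> V" "node T h (Suc l) \<noteq> node T i r"
  shows "1 \<le> l \<and> node T h l \<in> V"
proof -
  obtain j k where jk: "1 \<le> k" "node T h (Suc l) = node T j (k + 1)" "node T j k \<in> V"
    using assms unfolding finite_subtree_def by blast
  then have "k = l" by (simp add: node_def)
  then have "glued_at (Suc l) h j" using jk node_eq_iff[of "Suc l" h j] by simp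
  then have "glued_at l h j" by (rule glued_at_antimono) simp
  then show ?thesis using jk \<open>k = l\<close> node_eq_iff[of l h j] by simp
qed

lemma subtree_descends:
  assumes V: "finite_subtree T (node T i r) V" "1 \<le> r"
  shows "node T h l \<in> V \<Longrightarrow> 1 \<le> l \<Longrightarrow> r \<le> l \<and> glued_at r i h"
proof (induction l)
  case (Suc l)
  show ?case
  proof (cases "node T h (Suc l) = node T i r")
    case True
    then have "Suc l = r" by (rule node_eq_levelD)
    then show ?thesis using True node_eq_iff[of r i h] V(2) by simp
  next
    case False
    then show ?thesis using subtree_parent[OF V Suc.prems(1)] Suc.IH by auto
  qed
qed simp

text \<open>A subtree contains with a node all nodes between it and the root, so on a branch through
  the root it fills the levels from \<open>r\<close> to the greatest one, which exists by
  finiteness.\<close>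

lemma subtree_depth:
  assumes V: "finite_subtree T (node T i r) V" "1 \<le> r"
  shows "\<exists>D. \<forall>h l. 1 \<le> l \<longrightarrow> glued_at r i h \<longrightarrow> (node T h l \<in> V \<longleftrightarrow> r \<le> l \<and> l \<le> D h)"
proof -
  define D where "D h = Max {l. node T h l \<in> V}" for h
  have "node T h l \<in> V \<longleftrightarrow> r \<le> l \<and> l \<le> D h" if l: "1 \<le> l" and h: "glued_at r i h" for h l
  proof -
    have "finite {l. node T h l \<in> V}"
    proof (rule finite_imageD)
      show "finite (node T h ` {l. node T h l \<in> V})"
        using V unfolding finite_subtree_def by (auto intro: finite_subset[of _ V])
      show "inj_on (node T h) {l. node T h l \<in> V}"
        by (rule inj_onI) (erule node_eq_levelD)
    qed
    moreover have r: "node T h r \<in> V"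
      using V h node_eq_iff[of r i h] unfolding finite_subtree_def by simp
    ultimately have D: "node T h (D h) \<in> V" "\<And>k. node T h k \<in> V \<Longrightarrow> k \<le> D h"
      unfolding D_def using Max_in[of "{l. node T h l \<in> V}"] by (auto intro: Max_ge)
    have "node T h l \<in> V" if "r \<le> l" "l \<le> D h"
      using that(2,1)
    proof (induction l rule: inc_induct)
      case (step k)
      then have "node T h (Suc k) \<in> V" by simp
      moreover have "node T h (Suc k) \<noteq> node T i r" using step.prems by (auto dest: node_eq_levelD)
      ultimately show ?case using subtree_parent[OF V] by blast
    qed (rule D(1))
    then show ?thesis using D(2) subtree_descends[OF V] l by blast
  qed
  then show ?thesis by blast
qed

text \<open>Labels of nodes off branch \<open>h\<close> vanish at \<open>h\<close>, so only the
  nodes on that branch contribute.\<close>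

lemma subtree_sum:
  assumes V: "finite_subtree T (node T i r) V" "1 \<le> r"
    and D: "\<And>l. 1 \<le> l \<Longrightarrow> node T h l \<in> V \<longleftrightarrow> r \<le> l \<and> l \<le> D"
  shows "(\<Sum>v\<in>V. label T v) $ h = (\<Sum>l=r..D. E h l)"
proof -
  have "(\<Sum>v\<in>V. label T v) $ h = (\<Sum>v\<in>V. label T v $ h)" by simp
  also have "\<dots> = (\<Sum>v\<in>node T h ` {r..D}. label T v $ h)"
  proof (rule sum.mono_neutral_right)
    show "finite V" using V by (simp add: finite_subtree_def)
    show "node T h ` {r..D} \<subseteq> V" using D V(2) by auto
    show "\<forall>v\<in>V - node T h ` {r..D}. label T v $ h = 0"
    proof
      fix v assume v: "v \<in> V - node T h ` {r..D}"
      then obtain j l where "1 \<le> l" "v = node T j l" using subtree_nodeE[OF V] by blast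
      then show "label T v $ h = 0" using v D label_zero_iff by fastforce
    qed
  qed
  also have "\<dots> = (\<Sum>l=r..D. label T (node T h l) $ h)"
    by (subst sum.reindex) (auto intro: inj_onI dest: node_eq_levelD)
  also have "\<dots> = (\<Sum>l=r..D. E h l)" using V(2) by (intro sum.cong) (auto simp: label_nth)
  finally show ?thesis .
qed

text \<open>The node at level \<open>q\<close> is the sum of the other nodes of a subtree rooted
  there. By uniqueness of stops, the depth of this subtree on each branch through its root is the
  stop of \<open>q\<close>, and a node at level \<open>l\<close> shared by \<open>i\<close> and
  \<open>j\<close> is in it or not.\<close>

lemma stop_glued:
  assumes q: "1 \<le> q" and R: "glued_at l i j"
  shows "l \<le> stop (E i) q \<longleftrightarrow> l \<le> stop (E j) q"
proof (cases "l \<le> q")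
  case True
  have "q < stop (E h) q" for h
    using is_stop_iff[OF q, of h "stop (E h) q"] by (simp add: is_stop_def)
  then show ?thesis using True by (meson le_trans less_imp_le)
next
  case False
  obtain V where V: "finite_subtree T (node T i q) V"
    "label T (node T i q) = (\<Sum>v\<in>V - {node T i q}. label T v)"
    using tau q unfolding tau_trees_def by blast
  obtain D where D: "\<And>h l. 1 \<le> l \<Longrightarrow> glued_at q i h \<Longrightarrow> node T h l \<in> V \<longleftrightarrow> q \<le> l \<and> l \<le> D h"
    using subtree_depth[OF V(1) q] by blast
  have stop: "stop (E h) q = D h" if h: "glued_at q i h" for h
  proof -
    have root: "node T i q = node T h q" using node_eq_iff[OF q] h by blast
    have mem: "node T i q \<in> V" "finite V" using V(1) by (simp_all add: finite_subtree_def)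
    then have "q \<le> D h" using D[OF q h] root by simp
    have "(\<Sum>v\<in>V. label T v) = label T (node T i q) + label T (node T i q)"
      using sum.remove[OF mem(2,1), of "label T"] V(2) by simp
    then have "(\<Sum>k=q..D h. E h k) = E h q + E h q"
      using subtree_sum[OF V(1) q D[OF _ h]] label_nth[OF q, of h] root by simp
    moreover have "(\<Sum>k=q..D h. E h k) = E h q + (\<Sum>k=q+1..D h. E h k)"
      using sum.atLeast_Suc_atMost[OF \<open>q \<le> D h\<close>] by simp
    ultimately have sum: "E h q = (\<Sum>k=q+1..D h. E h k)" by simp
    have "0 < E h q" using mult[of h] q by (simp add: multiplicity_sequence_def)
    then have "q + 1 \<le> D h" using sum by (cases "q + 1 \<le> D h") auto
    then have "is_stop (E h) q (D h)" using sum by (simp add: is_stop_def)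
    then show ?thesis using is_stop_iff[OF q] by simp
  qed
  have "glued_at q i j" using glued_at_antimono[OF R] False by simp
  moreover have "node T i l = node T j l" using node_eq_iff R False by simp
  ultimately show ?thesis
    using stop[of i] stop[of j] glued_at_refl D[of l i] D[of l j] False q by simp
qed

lemma gluing_tree: "\<exists>L. gluing_tree E (\<lambda>i. stop (E i)) glued_at L"
proof -
  have "\<forall>i. \<exists>L. \<forall>l\<ge>L. E i l = 1" using mult by (simp add: multiplicity_sequence_def)
  then obtain K where K: "\<And>i l. K i \<le> l \<Longrightarrow> E i l = 1" by metis
  obtain K' where K': "\<And>l i. K' \<le> l \<Longrightarrow> label T (node T i l) = axis i 1"
    using tau unfolding tau_trees_def by blast
  define L where "L = Suc (K' + (\<Sum>i\<in>UNIV. K i))"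
  have KL: "K i \<le> L" for i
  proof -
    have "K i \<le> (\<Sum>i\<in>UNIV. K i)" by (rule member_le_sum) auto
    then show ?thesis by (simp add: L_def)
  qed
  have "gluing_tree E (\<lambda>i. stop (E i)) glued_at L"
  proof
    fix i j h :: 'n and q l k :: nat
    show "0 < E i l" if "1 \<le> l" using that mult[of i] by (simp add: multiplicity_sequence_def)
    show "E i l = 1" if "L \<le> l" using K KL le_trans that by blast
    show "q < stop (E i) q" "E i q = (\<Sum>k=q+1..stop (E i) q. E i k)" if "1 \<le> q"
      using is_stop_iff[OF that, of i "stop (E i) q"] by (simp_all add: is_stop_def)
    show "glued_at l i i" by (rule glued_at_refl)
    show "glued_at l j i" if "glued_at l i j" using that by (rule glued_at_sym)
    show "glued_at l i h" if "glued_at l i j" "glued_at l j h" using that by (rule glued_at_trans)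
    show "glued_at k i j" if "glued_at l i j" "k \<le> l" using that by (rule glued_at_antimono)
    show "glued_at 1 i j" using tau node_eq_iff[of 1 i j] by (auto simp: tau_trees_def)
    show "i = j" if "glued_at L i j"
    proof -
      have "1 \<le> L" "K' \<le> L" by (simp_all add: L_def)
      then have "label T (node T i L) $ j \<noteq> 0" using label_zero_iff node_eq_iff that by blast
      then show ?thesis using K'[OF \<open>K' \<le> L\<close>] by (simp add: axis_def split: if_splits)
    qed
    show "l \<le> stop (E i) q \<longleftrightarrow> l \<le> stop (E j) q" if "1 \<le> q" "glued_at l i j"
      using that by (rule stop_glued)
  qed simp
  then show ?thesis ..
qed

text \<open>Finite subtrees at the root correspond to the compatible depths without zeros; the zero
  vector corresponds to depth zero.\<close>

lemma tree_semigroup_eq: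
  assumes "gluing_tree E s glued_at L"
  shows "tree_semigroup T = gluing_tree.semigrp E glued_at"
proof -
  interpret gluing_tree E s glued_at L by fact
  show ?thesis
  proof (intro subset_antisym subsetI)
    fix x assume "x \<in> tree_semigroup T"
    then consider "x = 0" | V i where "finite_subtree T (node T i 1) V" "x = (\<Sum>v\<in>V. label T v)"
      unfolding tree_semigroup_def by blast
    then show "x \<in> semigrp"
    proof cases
      case 1
      then show ?thesis using zero_in_semigrp by simp
    next
      case 2
      obtain D where D: "\<And>h l. 1 \<le> l \<Longrightarrow> node T h l \<in> V \<longleftrightarrow> 1 \<le> l \<and> l \<le> D h"
        using subtree_depth[OF 2(1)] R_one by auto
      have "compat D" unfolding compat_def
      proof (intro allI impI)
        fix i j l assume "glued_at l i j"
        then show "l \<le> D i \<longleftrightarrow> l \<le> D j"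
          using D[of l i] D[of l j] node_eq_iff[of l i j] by (cases "l = 0") auto
      qed
      moreover have "x = vec_of D"
        using subtree_sum[OF 2(1) _ D] 2(2) by (simp add: vec_eq_iff height_def)
      ultimately show ?thesis by (simp add: semigrpI)
    qed
  next
    fix x assume "x \<in> semigrp"
    then obtain d where d: "compat d" "x = vec_of d" by (rule semigrpE)
    show "x \<in> tree_semigroup T"
    proof (cases "\<exists>i. d i = 0")
      case True
      then have "d j = 0" for j using compat_zero[OF d(1)] by blast
      then have "x = 0" using d(2) by (simp add: vec_eq_iff)
      then show ?thesis by (simp add: tree_semigroup_def)
    next
      case False
      define V where "V = (\<Union>h. node T h ` {1..d h})"
      fix i :: 'n
      have V: "finite_subtree T (node T i 1) V"
        unfolding finite_subtree_def
      proof (intro conjI ballI)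
        show "finite V" by (simp add: V_def)
        have "1 \<in> {1..d i}" using False by (simp add: Suc_le_eq)
        then show "node T i 1 \<in> V" unfolding V_def by blast
        show "node T i 1 \<in> {node T i l |i l. 1 \<le> l}" by blast
        fix v assume v: "v \<in> V - {node T i 1}"
        then obtain h l where hl: "v = node T h l" "1 \<le> l" "l \<le> d h" by (auto simp: V_def)
        moreover have "l \<noteq> 1" using v hl node_eq_iff[of 1 h i] R_one by auto
        ultimately have "1 \<le> l - 1" "v = node T h (l - 1 + 1)" "l - 1 \<in> {1..d h}"
          by auto
        then show "\<exists>i l. 1 \<le> l \<and> v = node T i (l + 1) \<and> node T i l \<in> V"
          unfolding V_def by blast
      qed
      \<comment> \<open>A node of branch \<open>h\<close> may enter \<open>V\<close> through another
        branch glued to \<open>h\<close> at its level; compatibility bounds the level by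
        \<open>d h\<close>.\<close>
      have "node T h l \<in> V \<longleftrightarrow> 1 \<le> l \<and> l \<le> d h" if "1 \<le> l" for h l
      proof
        assume "node T h l \<in> V"
        then obtain j k where "node T h l = node T j k" "k \<le> d j" by (auto simp: V_def)
        moreover from this have "k = l" using node_eq_levelD by metis
        ultimately show "1 \<le> l \<and> l \<le> d h"
          using that node_eq_iff[OF that, of h j] compatD[OF d(1)] by blast
      next
        assume "1 \<le> l \<and> l \<le> d h"
        then have "l \<in> {1..d h}" by simp
        then show "node T h l \<in> V" unfolding V_def by blast
      qed
      then have "x = (\<Sum>v\<in>V. label T v)"
        using subtree_sum[OF V] d(2) by (simp add: vec_eq_iff height_def)
      then show ?thesis using V unfolding tree_semigroup_def by blast
    qed
  qed
qed

end

theorem proposition4p9: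
  fixes E :: "'n::finite \<Rightarrow> nat \<Rightarrow> nat"
    and T :: "'n mtree"
  assumes "\<And>i. multiplicity_sequence (E i)"
    and "tree_semigroup T \<in> sigma_semigroups E"
  shows "\<exists>G :: (nat ^ 'n) set. is_Arf G (tree_semigroup T) \<and> finite G \<and>
           card G = C_num E + nat \<lceil>log 2 (real CARD('n))\<rceil>"
proof -
  \<comment> \<open>Membership in \<open>sigma_semigroups E\<close> yields a tree \<open>T'\<close>
    in \<open>tau_trees E\<close> with the same semigroup; the argument runs on this tree.\<close>
  obtain T' where T': "T' \<in> tau_trees E" "tree_semigroup T = tree_semigroup T'"
    using assms(2) by (auto simp: sigma_semigroups_def)
  then interpret multiplicity_tree E T' using assms(1) by unfold_locales
  obtain L where L: "gluing_tree E (\<lambda>i. stop (E i)) glued_at L" using gluing_tree by blast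
  show ?thesis
    using gluing_tree.exists_generators[OF L] tree_semigroup_eq[OF L] T'(2) by simp
qed

end
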